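(* Let $g\in L^\infty(\mathbb T)\setminus\{0\}$ be such that $\ker T_g\neq\{0\}$. Then $g\neq0$ a.e., and a function $k$ is a maximal vector for $\ker T_g$ if and only if $k\in H^2$ and $k=g^{-1}\,\overline{z}\,\overline{p}$ for some outer function $p\in H^2$.
   Context: $\mathbb D$ is the unit disc and $\mathbb T$ the unit circle with normalized Lebesgue measure. $H^2$ is the Hardy space of $\mathbb D$, identified with a closed subspace of $L^2(\mathbb T)$ via boundary values. $\overline{H^2_0}=L^2(\mathbb T)\ominus H^2$, and $z$ is the identity function. For $g\in L^\infty(\mathbb T)$, $T_gf=P(gf)$ on $H^2$, where $P$ is the orthogonal projection onto $H^2$; thus $\ker T_g=\{f\in H^2:gf\in\overline{H^2_0}\}$. A Toeplitz kernel is a subspace of the form $\ker T_v$ with $v\in L^\infty(\mathbb T)$. For $k\in H^2\setminus\{0\}$, $K_{\min}(k)$ denotes the minimal Toeplitz kernel containing $k$. That is, $K_{\min}(k)=\ker T_v$ with $k\in\ker T_v$ and $\ker T_v\subseteq\ker T_w$ for every $w\in L^\infty(\mathbb T)$ with $k\in\ker T_w$; it always exists. A function $k$ is a maximal vector for $\ker T_g$ if $\ker T_g=K_{\min}(k)$. *)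

theory Defs
  imports "HOL-Analysis.Analysis"
begin

(* The unit circle T is parametrised by t in [0, 2 pi), via t |-> cis t.
   A function on T is a function real => complex (only values on [0,2pi) matter);
   elements of L^p are handled as functions, with all identities taken a.e. *)
definition TT :: "real measure" where
  "TT = restrict_space lborel {0..<2*pi}"

definition L2 :: "(real \<Rightarrow> complex) \<Rightarrow> bool" where
  "L2 f \<longleftrightarrow> f \<in> borel_measurable TT \<and> integrable TT (\<lambda>t. (cmod (f t))^2)"

definition Linf :: "(real \<Rightarrow> complex) \<Rightarrow> bool" where
  "Linf g \<longleftrightarrow> g \<in> borel_measurable TT \<and> (\<exists>C. AE t in TT. cmod (g t) \<le> C)"

definition fcoeff :: "(real \<Rightarrow> complex) \<Rightarrow> int \<Rightarrow> complex" where
  "fcoeff f n = integral\<^sup>L TT (\<lambda>t. f t * cis (- (of_int n * t))) / complex_of_real (2*pi)"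

definition H2 :: "(real \<Rightarrow> complex) \<Rightarrow> bool" where
  "H2 f \<longleftrightarrow> L2 f \<and> (\<forall>n<0. fcoeff f n = 0)"

definition H2_0_conj :: "(real \<Rightarrow> complex) \<Rightarrow> bool" where
  "H2_0_conj f \<longleftrightarrow> L2 f \<and> (\<forall>n\<ge>0. fcoeff f n = 0)"

definition toeplitz_kernel :: "(real \<Rightarrow> complex) \<Rightarrow> (real \<Rightarrow> complex) set" where
  "toeplitz_kernel g = {f. H2 f \<and> H2_0_conj (\<lambda>t. g t * f t)}"

definition is_toeplitz_kernel :: "(real \<Rightarrow> complex) set \<Rightarrow> bool" where
  "is_toeplitz_kernel K \<longleftrightarrow> (\<exists>v. Linf v \<and> K = toeplitz_kernel v)"

definition is_min_toeplitz_kernel :: "(real \<Rightarrow> complex) \<Rightarrow> (real \<Rightarrow> complex) set \<Rightarrow> bool" where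
  "is_min_toeplitz_kernel k K \<longleftrightarrow>
     H2 k \<and> \<not> (AE t in TT. k t = 0) \<and> is_toeplitz_kernel K \<and> k \<in> K \<and>
     (\<forall>w. Linf w \<and> k \<in> toeplitz_kernel w \<longrightarrow> K \<subseteq> toeplitz_kernel w)"

definition maximal_vector :: "(real \<Rightarrow> complex) \<Rightarrow> (real \<Rightarrow> complex) \<Rightarrow> bool" where
  "maximal_vector g k \<longleftrightarrow> is_min_toeplitz_kernel k (toeplitz_kernel g)"

(* Outer function in H^2: its analytic extension P(z) = sum_n c_n z^n equals
   alpha * exp( (1/2pi) int (e^{it}+z)/(e^{it}-z) log|p(e^{it})| dt ), |alpha| = 1 *)
definition outer :: "(real \<Rightarrow> complex) \<Rightarrow> bool" where
  "outer p \<longleftrightarrow> H2 p \<and> (AE t in TT. p t \<noteq> 0) \<and>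
     integrable TT (\<lambda>t. ln (cmod (p t))) \<and>
     (\<exists>\<alpha>. cmod \<alpha> = 1 \<and>
        (\<forall>z. cmod z < 1 \<longrightarrow>
          (\<Sum>n. fcoeff p (int n) * z ^ n) =
            \<alpha> * exp (integral\<^sup>L TT (\<lambda>t. (cis t + z) / (cis t - z) * complex_of_real (ln (cmod (p t))))
                       / complex_of_real (2*pi))))"

end

theory Submission
  imports Defs "HOL-Complex_Analysis.Complex_Analysis"
begin

text \<open>
  A kernel element \<open>k\<close> is written through \<open>q\<close> with \<open>g k = cnj (z q)\<close>, \<open>q \<in> H\<^sup>2\<close>. If \<open>q\<close> is outer,
  \<open>k \<in> ker T\<^sub>w\<close> with \<open>w k = cnj (z r)\<close>, and \<open>f \<in> ker T\<^sub>g\<close> with \<open>g f = cnj (z h)\<close>, then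
  \<open>w f = cnj (z r h / q)\<close>, and \<open>r h / q\<close> is square integrable with outer denominator, hence in \<open>H\<^sup>2\<close>
  (Smirnov). Conversely let \<open>p\<close> be the outer function with \<open>|p| = |q|\<close> and \<open>I = q / p\<close>. For the
  bounded symbol \<open>g I\<close> one has \<open>k \<in> ker T\<^sub>g\<^sub>I\<close>, so minimality gives \<open>ker T\<^sub>g \<subseteq> ker T\<^sub>g\<^sub>I\<close>; applied to \<open>I k \<in> ker T\<^sub>g\<close>
  this puts \<open>p\<^sup>2 / q\<close> into \<open>H\<^sup>2\<close>. In the disc \<open>q \<cdot> (p\<^sup>2 / q) = p\<^sup>2\<close>, while by Jensen both factors are
  dominated by \<open>|p|\<close>; therefore \<open>|q| = |p|\<close> there and \<open>q\<close> is a unimodular multiple of \<open>p\<close>.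

  No radial limits are needed: \<open>H\<^sup>2\<close> functions are recovered from their power series by Riesz--Fischer,
  and the modulus of an outer function on the circle is identified by combining Jensen's inequality
  (which gives \<open>|q| \<le> |p|\<close>) with \<open>\<parallel>p\<parallel> \<le> \<parallel>q\<parallel>\<close>.
\<close>

subsection \<open>The measure space of the circle\<close>

text \<open>The engine is Jensen's inequality: for nonzero f in \<open>H2\<close>, |f(z)| is at most
  the exponential of the Poisson integral of ln |f|, with equality for outer functions. Upper bounds
  for numerators and equality for an outer denominator control a quotient; convexity of exp turns
  this into a harmonic majorant of its squared modulus, and such a majorant puts a holomorphic
  function back into \<open>H2\<close>. One obstacle is that ln is unbounded near zeros. Jensen is
  therefore proved with ln (|f| + e), first for polynomials, and e is sent to 0 at the end; the same
  limit shows that f vanishes only on a null set, which is where g \<noteq> 0 a.e. comes from.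
  Another obstacle is that a product of two \<open>H2\<close> functions is merely integrable, so
  disc and circle have to be compared in L1. For this reason uniqueness of Fourier coefficients is
  derived from mean convergence of Poisson integrals. The symbol g I is chosen because |p| = |q|
  gives conj I = p / q: passing from g to g I replaces q by p for the vector k, and I k then yields
  p^2 / q.\<close>

lemma space_TT [simp]: "space TT = {0..<2*pi}"
  by (simp add: TT_def space_restrict_space)

lemma finite_measure_TT: "finite_measure TT"
  by (rule finite_measureI) (simp add: TT_def space_restrict_space emeasure_restrict_space)

interpretation TT: finite_measure TT by (rule finite_measure_TT)

interpretation TT: pair_sigma_finite TT TT ..

lemma measure_TT [simp]: "measure TT {0..<2*pi} = 2*pi"
  by (simp add: TT_def measure_restrict_space)

lemma measurable_TT_I: "f \<in> borel_measurable borel \<Longrightarrow> f \<in> borel_measurable TT"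
  unfolding TT_def by (rule measurable_restrict_space1) simp

lemma continuous_measurable_TT:
  fixes f :: "real \<Rightarrow> 'b::topological_space"
  shows "continuous_on UNIV f \<Longrightarrow> f \<in> borel_measurable TT"
  by (intro measurable_TT_I borel_measurable_continuous_onI)

lemma cis_of_int_measurable [measurable]:
  "(\<lambda>t. cis (of_int n * t)) \<in> borel_measurable TT"
  "(\<lambda>t. cis (- (of_int n * t))) \<in> borel_measurable TT"
  "(\<lambda>t. cis (- t)) \<in> borel_measurable TT"
  "cis \<in> borel_measurable TT"
  by (auto intro!: continuous_measurable_TT continuous_intros)

lemma integrable_TT_bounded:
  fixes f :: "real \<Rightarrow> 'b::{banach, second_countable_topology}"
  assumes "f \<in> borel_measurable TT" "\<And>t. norm (f t) \<le> B"
  shows "integrable TT f"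
  by (rule TT.integrable_const_bound[of _ B]) (use assms in auto)

lemma integral_TT_cis:
  "integral\<^sup>L TT (\<lambda>t. cis (of_int n * t)) = (if n = 0 then complex_of_real (2*pi) else 0)"
proof (cases "n = 0")
  case True
  then show ?thesis by (simp add: scaleR_conv_of_real)
next
  case False
  have "integral\<^sup>L TT (\<lambda>t. cis (of_int n * t)) =
      (\<integral>t. indicator {0..<2*pi} t *\<^sub>R cis (of_int n * t) \<partial>lborel)"
    unfolding TT_def by (subst integral_restrict_space) auto
  \<comment> \<open>Adding the null point \<open>2*pi\<close> gives a closed interval, as the
    fundamental theorem of calculus requires.\<close>
  also have "\<dots> = (\<integral>t. indicator {0..2*pi} t *\<^sub>R cis (of_int n * t) \<partial>lborel)"
  proof (rule integral_cong_AE)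
    show "AE t in lborel. indicator {0..<2 * pi} t *\<^sub>R cis (of_int n * t) =
        indicator {0..2 * pi} t *\<^sub>R cis (of_int n * t)"
      using AE_lborel_singleton[of "2*pi"] by eventually_elim (auto split: split_indicator)
  qed (intro borel_measurable_scaleR borel_measurable_indicator; force intro!: borel_measurable_continuous_onI continuous_intros)+
  also have "\<dots> = cis (of_int n * (2*pi)) / (\<i> * of_int n) - cis (of_int n * 0) / (\<i> * of_int n)"
  proof (rule integral_FTC_Icc)
    show "((\<lambda>t. cis (of_int n * t) / (\<i> * of_int n)) has_vector_derivative cis (of_int n * t))
        (at t within {0..2*pi})" for t
    proof -
      have "((\<lambda>t. exp (\<i> * of_int n * of_real t) / (\<i> * of_int n)) has_vector_derivative
          exp (\<i> * of_int n * of_real t)) (at t within {0..2*pi})"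
        using False
        by (auto intro!: derivative_eq_intros has_vector_derivative_real_field)
      moreover have "(\<lambda>t. exp (\<i> * of_int n * of_real t)) = (\<lambda>t. cis (of_int n * t))"
        by (auto simp: cis_conv_exp fun_eq_iff mult_ac)
      ultimately show ?thesis by metis
    qed
  qed (auto intro!: continuous_intros)
  also have "\<dots> = 0"
    using cis_multiple_2pi[of "of_int n"] by (simp add: mult.commute)
  finally show ?thesis using False by simp
qed

section \<open>Fourier coefficients of integrable functions\<close>

lemma integrable_mult_cis:
  fixes f :: "real \<Rightarrow> complex"
  assumes "integrable TT f"
  shows "integrable TT (\<lambda>t. f t * cis (- (of_int n * t)))"
  by (rule Bochner_Integration.integrable_bound[OF assms])
     (use assms in \<open>auto simp: norm_mult\<close>)

lemma fcoeff_cong_AE: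
  assumes "f \<in> borel_measurable TT" "g \<in> borel_measurable TT" "AE t in TT. f t = g t"
  shows "fcoeff f n = fcoeff g n"
  unfolding fcoeff_def
  by (intro arg_cong2[where f = "(/)"] refl integral_cong_AE) (use assms in auto)

lemma fcoeff_diff:
  assumes "integrable TT f" "integrable TT g"
  shows "fcoeff (\<lambda>t. f t - g t) n = fcoeff f n - fcoeff g n"
  unfolding fcoeff_def left_diff_distrib
  using assms by (simp add: integrable_mult_cis diff_divide_distrib)

lemma norm_fcoeff_le:
  assumes "integrable TT f"
  shows "norm (fcoeff f n) \<le> integral\<^sup>L TT (\<lambda>t. norm (f t)) / (2*pi)"
proof -
  have "norm (integral\<^sup>L TT (\<lambda>t. f t * cis (- (of_int n * t)))) \<le>
      integral\<^sup>L TT (\<lambda>t. norm (f t * cis (- (of_int n * t))))"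
    by (rule integral_norm_bound)
  then show ?thesis
    unfolding fcoeff_def by (simp add: norm_divide norm_mult divide_right_mono)
qed

lemma fcoeff_cnj: "fcoeff (\<lambda>t. cnj (f t)) n = cnj (fcoeff f (- n))"
proof -
  have "integral\<^sup>L TT (\<lambda>t. cnj (f t) * cis (- (of_int n * t))) =
      cnj (integral\<^sup>L TT (\<lambda>t. f t * cis (- (of_int (- n) * t))))"
    by (subst Bochner_Integration.integral_cnj[symmetric]) (simp add: cis_cnj)
  then show ?thesis unfolding fcoeff_def by simp
qed

text \<open>Conjugation sends frequency n to -n and the factor conj z shifts by one more, so
  negative and nonnegative frequencies trade places. This makes \<open>H2_0_conj\<close> a mirror
  image of \<open>H2\<close>.\<close>

lemma fcoeff_cis_mult_cnj: "fcoeff (\<lambda>t. cis (- t) * cnj (f t)) n = cnj (fcoeff f (- n - 1))"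
proof -
  have "fcoeff (\<lambda>t. cis (- t) * cnj (f t)) n = fcoeff (\<lambda>t. cnj (f t)) (n + 1)"
    unfolding fcoeff_def
    by (intro arg_cong2[where f = "(/)"] refl Bochner_Integration.integral_cong)
       (auto simp: cis_mult algebra_simps)
  then show ?thesis by (simp add: fcoeff_cnj)
qed

lemma fcoeff_cis: "fcoeff (\<lambda>t. cis (of_int m * t)) n = (if n = m then 1 else 0)"
proof -
  have "(\<lambda>t. cis (of_int m * t) * cis (- (of_int n * t))) = (\<lambda>t. cis (of_int (m - n) * t))"
    by (auto simp: cis_mult algebra_simps)
  then show ?thesis
    unfolding fcoeff_def using integral_TT_cis[of "m - n"] by auto
qed

subsection \<open>Herglotz and Poisson kernels\<close>

definition hkernel :: "complex \<Rightarrow> real \<Rightarrow> complex" where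
  "hkernel z t = (cis t + z) / (cis t - z)"

text \<open>The Schwarz integral. The exponent in \<open>outer\<close> is \<open>herg\<close> of the
  log modulus, and its real part is the Poisson integral \<open>pint\<close>.\<close>

definition herg :: "(real \<Rightarrow> real) \<Rightarrow> complex \<Rightarrow> complex" where
  "herg \<phi> z = integral\<^sup>L TT (\<lambda>t. hkernel z t * complex_of_real (\<phi> t)) / complex_of_real (2*pi)"

definition pois :: "complex \<Rightarrow> real \<Rightarrow> real" where
  "pois z t = Re (hkernel z t)"

definition pint :: "(real \<Rightarrow> real) \<Rightarrow> complex \<Rightarrow> real" where
  "pint \<phi> z = integral\<^sup>L TT (\<lambda>t. pois z t * \<phi> t) / (2*pi)"

lemma cis_minus_nonzero: "norm z < 1 \<Longrightarrow> cis t - z \<noteq> 0"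
  by (metis eq_iff_diff_eq_0 less_irrefl norm_cis)

lemma hkernel_measurable [measurable]: "hkernel z \<in> borel_measurable TT"
  unfolding hkernel_def by measurable

lemma pois_measurable [measurable]: "pois z \<in> borel_measurable TT"
  unfolding pois_def by measurable

lemma norm_cis_minus_ge: "1 - norm z \<le> norm (cis t - z)"
  by (metis norm_cis norm_triangle_ineq2)

lemma norm_hkernel_le:
  assumes "norm z < 1"
  shows "norm (hkernel z t) \<le> 2 / (1 - norm z)"
proof -
  have "norm (cis t + z) \<le> 2"
    using norm_triangle_ineq[of "cis t" z] assms by simp
  then show ?thesis
    unfolding hkernel_def norm_divide
    using norm_cis_minus_ge[of z t] assms by (intro frac_le) auto
qed

lemma pois_eq: "pois z t = (1 - (norm z)\<^sup>2) / (norm (cis t - z))\<^sup>2"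
proof -
  have "Re ((cis t + z) * cnj (cis t - z)) = 1 - (norm z)\<^sup>2"
    unfolding cmod_power2 using sin_cos_squared_add[of t]
    by (simp add: algebra_simps power2_eq_square)
  then show ?thesis
    unfolding pois_def hkernel_def
    by (metis Re_divide_of_real complex_div_cnj of_real_power)
qed

lemma pois_pos: "norm z < 1 \<Longrightarrow> pois z t > 0"
  unfolding pois_eq using cis_minus_nonzero[of z t] by (simp add: power_less_one_iff abs_square_less_1)

lemma pois_le: "norm z < 1 \<Longrightarrow> pois z t \<le> 2 / (1 - norm z)"
  using norm_hkernel_le[of z t] complex_Re_le_cmod[of "hkernel z t"] unfolding pois_def by linarith

text \<open>For fixed \<open>z\<close> this bound is positive, so integrability against the Poisson
  weight implies plain integrability. Log integrability of \<open>H2\<close> functions is obtained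
  that way.\<close>

lemma pois_ge:
  assumes "norm z < 1"
  shows "pois z t \<ge> (1 - (norm z)\<^sup>2) / 4"
proof -
  have "norm (cis t - z) \<le> 2"
    using norm_triangle_ineq4[of "cis t" z] assms by simp
  then have "(norm (cis t - z))\<^sup>2 \<le> 2\<^sup>2"
    by (intro power_mono) auto
  then show ?thesis
    unfolding pois_eq using assms cis_minus_nonzero[of z t]
    by (intro frac_le) (auto simp: abs_square_le_1)
qed

text \<open>Both distances equal |1 - r cis (s - t)| up to conjugation. Under Fubini this symmetry
  lets the two angles exchange roles.\<close>

lemma pois_sym:
  "pois (of_real r * cis s) t = pois (of_real r * cis t) s"
proof -
  have "norm (cis t - of_real r * cis s) = norm (cis s - of_real r * cis t)"
    by (simp add: cmod_def power2_eq_square algebra_simps)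
      (use sin_cos_squared_add[of t] sin_cos_squared_add[of s] in algebra)
  then show ?thesis by (simp add: pois_eq norm_mult)
qed

lemma integrable_hkernel_mult:
  fixes f :: "real \<Rightarrow> complex"
  assumes "integrable TT f" "norm z < 1"
  shows "integrable TT (\<lambda>t. hkernel z t * f t)"
proof (rule Bochner_Integration.integrable_bound)
  show "integrable TT (\<lambda>t. (2 / (1 - norm z)) * norm (f t))"
    using assms by auto
  show "AE t in TT. norm (hkernel z t * f t) \<le> norm ((2 / (1 - norm z)) * norm (f t))"
    using norm_hkernel_le[OF assms(2)] assms(2)
    by (auto simp: norm_mult intro!: mult_right_mono simp del: times_divide_eq_left)
qed (use assms in measurable)

lemma integrable_pois_mult:
  fixes f :: "real \<Rightarrow> real"
  assumes "integrable TT f" "norm z < 1"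
  shows "integrable TT (\<lambda>t. pois z t * f t)"
  using integrable_Re[OF integrable_hkernel_mult[OF integrable_of_real[OF assms(1)] assms(2)]]
  by (simp add: pois_def)

lemma Re_herg:
  assumes "integrable TT \<phi>" "norm z < 1"
  shows "Re (herg \<phi> z) = pint \<phi> z"
  unfolding herg_def pint_def Re_divide_of_real
  using integral_Re[OF integrable_hkernel_mult[OF integrable_of_real[OF assms(1)] assms(2)]]
  by (simp add: pois_def)

lemma hkernel_sums:
  assumes "norm z < 1"
  shows "(\<lambda>n. (if n = 0 then 1 else 2) * z ^ n * cis (- (of_int (int n) * t))) sums hkernel z t"
proof -
  \<comment> \<open>Dividing by \<open>cis t\<close> turns the kernel into (1 + w) / (1 - w) = 2 /
    (1 - w) - 1, a geometric series whose constant term is 1 instead of 2.\<close>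
  define w where "w = z * cis (- t)"
  have w: "norm w < 1" using assms by (simp add: w_def norm_mult)
  have "(\<lambda>n. 2 * w ^ n - (if n = 0 then 1 else 0)) sums (2 * (1 / (1 - w)) - 1)"
    by (intro sums_diff sums_mult geometric_sums w) (rule sums_single)
  moreover have "2 * (1 / (1 - w)) - 1 = hkernel z t"
  proof -
    have z: "z = w * cis t" by (simp add: w_def mult.assoc cis_mult)
    have "hkernel z t = (cis t * (1 + w)) / (cis t * (1 - w))"
      unfolding hkernel_def z by (simp add: algebra_simps)
    also have "\<dots> = (1 + w) / (1 - w)" by simp
    also have "\<dots> = 2 * (1 / (1 - w)) - 1"
    proof -
      have "1 - w \<noteq> 0" using w by auto
      then show ?thesis by (simp add: field_simps)
    qed
    finally show ?thesis by simp
  qed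
  moreover have "(\<lambda>n. 2 * w ^ n - (if n = 0 then 1 else 0)) =
      (\<lambda>n. (if n = 0 then 1 else 2) * z ^ n * cis (- (of_int (int n) * t)))"
    by (auto simp: fun_eq_iff w_def power_mult_distrib Complex.DeMoivre simp del: mult_cancel_left)
  ultimately show ?thesis by simp
qed

text \<open>Termwise integration, dominated by a geometric series times |f|. It gives holomorphy of
  \<open>herg\<close>, total mass one of the Poisson kernel, and the vanishing of these integrals
  when all coefficients vanish.\<close>

lemma integral_hkernel_sums:
  fixes f :: "real \<Rightarrow> complex"
  assumes f: "integrable TT f" and z: "norm z < 1"
  shows "(\<lambda>n. (if n = 0 then 1 else 2) * fcoeff f (int n) * z ^ n) sums
    (integral\<^sup>L TT (\<lambda>t. hkernel z t * f t) / complex_of_real (2*pi))"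
proof -
  define a where "a n t = ((if n = 0 then 1 else 2) * z ^ n * cis (- (of_int (int n) * t))) * f t"
    for n :: nat and t
  have na: "norm (a n t) = (if n = 0 then 1 else 2) * norm z ^ n * norm (f t)" for n t
    by (simp add: a_def norm_mult norm_power)
  have i: "integrable TT (a n)" for n
    using integrable_mult_right[OF integrable_mult_cis[OF f, of "int n"], of "(if n = 0 then 1 else 2) * z ^ n"]
    by (simp add: a_def[abs_def] mult_ac)
  have sm: "summable (\<lambda>n. (if n = 0 then 1 else 2) * norm z ^ n * c)" for c :: real
    by (rule summable_mult2, rule summable_comparison_test'[of "\<lambda>n. 2 * norm z ^ n"])
       (use z in \<open>auto intro!: summable_mult summable_geometric\<close>)
  have ii: "integral\<^sup>L TT (\<lambda>t. norm (a n t)) =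
      (if n = 0 then 1 else 2) * norm z ^ n * integral\<^sup>L TT (\<lambda>t. norm (f t))" for n
    by (simp add: na)
  have "(\<lambda>n. integral\<^sup>L TT (a n)) sums integral\<^sup>L TT (\<lambda>t. \<Sum>n. a n t)"
  proof (rule sums_integral[OF i])
    show "AE t in TT. summable (\<lambda>n. norm (a n t))"
      unfolding na using sm by simp
    show "summable (\<lambda>n. \<integral>t. norm (a n t) \<partial>TT)"
      unfolding ii by (rule sm)
  qed
  moreover have "(\<Sum>n. a n t) = hkernel z t * f t" for t
    unfolding a_def by (rule sums_unique[symmetric], rule sums_mult2, rule hkernel_sums[OF z])
  moreover have "integral\<^sup>L TT (a n) =
      (if n = 0 then 1 else 2) * fcoeff f (int n) * z ^ n * complex_of_real (2*pi)" for n
  proof -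
    have "integral\<^sup>L TT (a n) = (\<integral>t. ((if n = 0 then 1 else 2) * z ^ n) * (f t * cis (- (of_int (int n) * t))) \<partial>TT)"
      by (simp add: a_def[abs_def] mult_ac)
    then show ?thesis by (simp add: fcoeff_def)
  qed
  ultimately have "(\<lambda>n. ((if n = 0 then 1 else 2) * fcoeff f (int n) * z ^ n) * complex_of_real (2*pi)) sums
      integral\<^sup>L TT (\<lambda>t. hkernel z t * f t)" by simp
  from sums_divide[OF this, of "complex_of_real (2*pi)"] show ?thesis by simp
qed

lemma herg_sums:
  assumes "integrable TT \<phi>" "norm z < 1"
  shows "(\<lambda>n. ((if n = 0 then 1 else 2) * fcoeff (\<lambda>t. complex_of_real (\<phi> t)) (int n)) * z ^ n) sums herg \<phi> z"
  using integral_hkernel_sums[OF integrable_of_real[OF assms(1)] assms(2)] by (simp add: herg_def)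

lemma herg_holomorphic:
  assumes "integrable TT \<phi>"
  shows "herg \<phi> holomorphic_on ball 0 1"
  by (rule power_series_holomorphic) (use herg_sums[OF assms] in auto)

section \<open>Poisson integrals as averages: mass, monotonicity, convexity\<close>

lemma pint_const: "norm z < 1 \<Longrightarrow> pint (\<lambda>_. c) z = c"
proof -
  assume z: "norm z < 1"
  have *: "integrable TT (\<lambda>_. c)" by (rule integrable_TT_bounded[of _ "\<bar>c\<bar>"]) auto
  have c: "fcoeff (\<lambda>_. complex_of_real c) (int n) = (if n = 0 then c else 0)" for n
  proof -
    have "fcoeff (\<lambda>_. complex_of_real c) (int n) = c * fcoeff (\<lambda>t. cis (of_int 0 * t)) (int n)"
      unfolding fcoeff_def by (simp del: integral_const)
    then show ?thesis unfolding fcoeff_cis by simp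
  qed
  have "(\<lambda>n. ((if n = 0 then 1 else 2) * fcoeff (\<lambda>t. complex_of_real c) (int n)) * z ^ n) =
     (\<lambda>n. if n = 0 then complex_of_real c else 0)" by (auto simp: c)
  then have "herg (\<lambda>_. c) z = c"
    using herg_sums[OF * z] sums_unique2[OF sums_single[of 0 "\<lambda>_. complex_of_real c"]] by metis
  then show ?thesis using Re_herg[OF * z] by simp
qed

lemma pint_add:
  "integrable TT f \<Longrightarrow> integrable TT g \<Longrightarrow> norm z < 1 \<Longrightarrow> pint (\<lambda>t. f t + g t) z = pint f z + pint g z"
  unfolding pint_def by (simp add: distrib_left integrable_pois_mult add_divide_distrib)

lemma pint_diff:
  "integrable TT f \<Longrightarrow> integrable TT g \<Longrightarrow> norm z < 1 \<Longrightarrow> pint (\<lambda>t. f t - g t) z = pint f z - pint g z"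
  unfolding pint_def by (simp add: right_diff_distrib integrable_pois_mult diff_divide_distrib)

lemma pint_cmult: "pint (\<lambda>t. c * f t) z = c * pint f z"
  unfolding pint_def by (simp add: mult.left_commute[of _ c])

lemma pint_mono_AE:
  assumes "integrable TT f" "integrable TT g" "norm z < 1" "AE t in TT. f t \<le> g t"
  shows "pint f z \<le> pint g z"
  unfolding pint_def
  by (intro divide_right_mono integral_mono_AE integrable_pois_mult assms)
     (use assms(4) pois_pos[OF assms(3)] in \<open>auto simp: mult_left_mono less_imp_le\<close>)

lemma pint_cong_AE:
  assumes "f \<in> borel_measurable TT" "g \<in> borel_measurable TT" "AE t in TT. f t = g t"
  shows "pint f z = pint g z"
  unfolding pint_def
  by (intro arg_cong2[where f = "(/)"] refl integral_cong_AE) (use assms in auto)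

text \<open>Convexity: the tangent line of exp at the mean \<open>m\<close> lies below exp, and
  averaging it against a kernel of mass one returns \<open>exp m\<close>.\<close>

lemma exp_pint_le:
  assumes f: "integrable TT f" and g: "integrable TT (\<lambda>t. exp (f t))" and z: "norm z < 1"
  shows "exp (pint f z) \<le> pint (\<lambda>t. exp (f t)) z"
proof -
  define m where "m = pint f z"
  have c: "integrable TT (\<lambda>_. a :: real)" for a by (rule integrable_TT_bounded[of _ "\<bar>a\<bar>"]) auto
  have "pint (\<lambda>t. exp m * (1 + (f t - m))) z = exp m * (1 + (m - m))"
    using pint_cmult pint_add pint_diff pint_const[OF z] c f z
    by (simp add: pint_cmult pint_add pint_diff pint_const[OF z] c f z m_def[symmetric])
  moreover have "pint (\<lambda>t. exp m * (1 + (f t - m))) z \<le> pint (\<lambda>t. exp (f t)) z"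
  proof (rule pint_mono_AE)
    show "AE t in TT. exp m * (1 + (f t - m)) \<le> exp (f t)"
    proof (rule AE_I2)
      fix t
      have "exp m * (1 + (f t - m)) \<le> exp m * exp (f t - m)"
        by (intro mult_left_mono exp_ge_add_one_self) auto
      then show "exp m * (1 + (f t - m)) \<le> exp (f t)"
        by (simp add: exp_diff)
    qed
  qed (use f g z c in auto)
  ultimately show ?thesis by (simp add: m_def)
qed

subsection \<open>Poisson integrals as an approximate identity in \<open>L\<^sup>1\<close>\<close>

lemma integrable_TT_const: "integrable TT (\<lambda>_. c :: 'b::{banach, second_countable_topology})"
  by (rule integrable_TT_bounded[of _ "norm c"]) auto

lemma LIMSEQ_squeeze_0:
  fixes f g :: "nat \<Rightarrow> real"
  assumes "\<And>n. 0 \<le> f n" "\<And>n. f n \<le> g n" "g \<longlonglongrightarrow> 0"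
  shows "f \<longlonglongrightarrow> 0"
  by (rule tendsto_sandwich[OF _ _ tendsto_const assms(3)]) (use assms in auto)

lemma abs_pint_le:
  assumes "integrable TT f" "norm z < 1"
  shows "\<bar>pint f z\<bar> \<le> pint (\<lambda>t. \<bar>f t\<bar>) z"
proof -
  have "\<bar>integral\<^sup>L TT (\<lambda>t. pois z t * f t)\<bar> \<le> integral\<^sup>L TT (\<lambda>t. \<bar>pois z t * f t\<bar>)"
    by (rule integral_abs_bound)
  also have "\<dots> = integral\<^sup>L TT (\<lambda>t. pois z t * \<bar>f t\<bar>)"
    using pois_pos[OF assms(2)] by (simp add: abs_mult less_imp_le)
  finally show ?thesis unfolding pint_def by (simp add: divide_right_mono)
qed

lemma norm_of_real_mult_cis [simp]: "norm (complex_of_real r * cis s) = \<bar>r\<bar>"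
  by (simp add: norm_mult)

text \<open>Near \<open>cis s\<close> the oscillation \<open>\<eta>\<close> is averaged. Elsewhere
  \<open>1 - r \<le> \<delta> / 2\<close> forces |cis t - z| \<ge> \<delta> / 2 for z = r cis s, so
  the kernel is at most \<open>4 * (1 - r^2) / \<delta>^2\<close>, while |f - c| \<le> 2 M; this
  explains the factor 8. Closeness is measured by chords because angles near 0 and near
  \<open>2*pi\<close> are neighbours on the circle.\<close>

lemma pint_near_boundary_value:
  assumes m: "f \<in> borel_measurable TT" and b: "\<And>t. \<bar>f t\<bar> \<le> M" "\<bar>c\<bar> \<le> M"
    and near: "\<And>t. t \<in> {0..<2*pi} \<Longrightarrow> norm (cis t - cis s) < \<delta> \<Longrightarrow> \<bar>f t - c\<bar> \<le> \<eta>"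
    and d: "\<delta> > 0" "\<eta> \<ge> 0" and r: "0 \<le> r" "r < 1" "1 - r \<le> \<delta> / 2"
  shows "\<bar>pint f (of_real r * cis s) - c\<bar> \<le> \<eta> + 8 * M * (1 - r\<^sup>2) / \<delta>\<^sup>2"
proof -
  let ?z = "complex_of_real r * cis s"
  have z: "norm ?z < 1" using r by simp
  have r2: "r\<^sup>2 \<le> 1" using r by (simp add: abs_square_le_1)
  have M: "M \<ge> 0" using b(2) by linarith
  define E where "E = 8 * M * (1 - r\<^sup>2) / \<delta>\<^sup>2"
  have E: "E \<ge> 0" unfolding E_def using M r2 by auto
  have i: "integrable TT f" by (rule integrable_TT_bounded[of _ M]) (use m b in auto)
  have i': "integrable TT (\<lambda>t. \<bar>f t - c\<bar>)" using i integrable_TT_const by auto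
  have pt: "pois ?z t * \<bar>f t - c\<bar> \<le> pois ?z t * \<eta> + E" if t: "t \<in> {0..<2*pi}" for t
  proof (cases "norm (cis t - cis s) < \<delta>")
    case True
    have "pois ?z t * \<bar>f t - c\<bar> \<le> pois ?z t * \<eta>"
      using near[OF t True] pois_pos[OF z, of t] by (simp add: mult_left_mono)
    with E show ?thesis by linarith
  next
    case False
    have "norm (cis s - ?z) = 1 - r"
    proof -
      have "cis s - ?z = of_real (1 - r) * cis s" by (simp add: algebra_simps)
      then show ?thesis using r by (simp only: norm_of_real_mult_cis)
    qed
    then have "norm (cis t - cis s) \<le> norm (cis t - ?z) + (1 - r)"
      using norm_triangle_ineq4[of "cis t - ?z" "cis s - ?z"] by simp
    then have "\<delta> / 2 \<le> norm (cis t - ?z)"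
      using False r by linarith
    then have "(\<delta> / 2)\<^sup>2 \<le> (norm (cis t - ?z))\<^sup>2"
      using d by (intro power_mono) auto
    then have "pois ?z t \<le> (1 - r\<^sup>2) / (\<delta> / 2)\<^sup>2"
      unfolding pois_eq using d r r2 by (intro frac_le) auto
    moreover have "\<bar>f t - c\<bar> \<le> 2 * M" using b(1)[of t] b(2) by linarith
    ultimately have "pois ?z t * \<bar>f t - c\<bar> \<le> (1 - r\<^sup>2) / (\<delta> / 2)\<^sup>2 * (2 * M)"
      using r2 M by (intro mult_mono) auto
    also have "\<dots> = E" unfolding E_def by (simp add: power2_eq_square)
    finally show ?thesis
      using pois_pos[OF z, of t] d by (smt (verit) mult_nonneg_nonneg)
  qed
  have "\<bar>pint f ?z - c\<bar> = \<bar>pint (\<lambda>t. f t - c) ?z\<bar>"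
    by (subst pint_diff[OF i integrable_TT_const z]) (simp add: pint_const[OF z])
  also have "\<dots> \<le> pint (\<lambda>t. \<bar>f t - c\<bar>) ?z"
    by (rule abs_pint_le) (use i integrable_TT_const z in auto)
  also have "\<dots> \<le> integral\<^sup>L TT (\<lambda>t. pois ?z t * \<eta> + E) / (2*pi)"
    unfolding pint_def
    by (intro divide_right_mono integral_mono integrable_pois_mult i' z Bochner_Integration.integrable_add integrable_TT_const)
       (use pt in auto)
  also have "\<dots> = pint (\<lambda>_. \<eta>) ?z + E"
    unfolding pint_def
    using integrable_pois_mult[OF integrable_TT_const z, of \<eta>]
    by (subst Bochner_Integration.integral_add)
       (auto intro!: integrable_TT_const simp: add_divide_distrib)
  finally show ?thesis using pint_const[OF z] by (simp add: E_def)
qed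

text \<open>Fubini, with the kernel bounded by \<open>2 / (1 - r)\<close>. After exchanging the
  angles by \<open>pois_sym\<close> the inner integral is the Poisson integral of the constant
  1.\<close>

lemma
  assumes f: "integrable TT f" and r: "0 \<le> r" "r < 1"
  shows integrable_pint_circle: "integrable TT (\<lambda>s. pint f (of_real r * cis s))"
    and integral_pint_circle: "integral\<^sup>L TT (\<lambda>s. pint f (of_real r * cis s)) = integral\<^sup>L TT f"
proof -
  have z: "norm (complex_of_real r * cis s) < 1" for s using r by simp
  have [measurable]: "f \<in> borel_measurable TT" using f by auto
  have [measurable]: "(\<lambda>(s, t). pois (complex_of_real r * cis s) t * f t) \<in> borel_measurable (TT \<Otimes>\<^sub>M TT)"
    unfolding pois_eq by measurable
  have *: "integrable (TT \<Otimes>\<^sub>M TT) (\<lambda>(s, t). pois (complex_of_real r * cis s) t * f t)"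
  proof (rule Bochner_Integration.integrable_bound)
    show "integrable (TT \<Otimes>\<^sub>M TT) (\<lambda>(s, t). (2 / (1 - r)) * f t)"
      by (rule TT.Fubini_integrable) (use f integrable_TT_const in auto)
    show "AE x in TT \<Otimes>\<^sub>M TT. norm (case x of (s, t) \<Rightarrow> pois (complex_of_real r * cis s) t * f t)
         \<le> norm (case x of (s, t) \<Rightarrow> 2 / (1 - r) * f t)"
    proof (rule AE_I2, clarify)
      fix s t
      show "norm (pois (complex_of_real r * cis s) t * f t) \<le> norm (2 / (1 - r) * f t)"
        using pois_le[OF z, of s t] pois_pos[OF z, of s t] r
        by (auto simp: abs_mult intro!: mult_right_mono simp del: times_divide_eq_left)
    qed
  qed measurable
  show "integrable TT (\<lambda>s. pint f (of_real r * cis s))"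
    unfolding pint_def using TT.integrable_fst[OF *] by simp
  have "integral\<^sup>L TT (\<lambda>s. pint f (of_real r * cis s)) =
     (\<integral>s. (\<integral>t. pois (complex_of_real r * cis s) t * f t \<partial>TT) \<partial>TT) / (2 * pi)"
    unfolding pint_def by simp
  also have "\<dots> = (\<integral>t. (\<integral>s. pois (complex_of_real r * cis s) t * f t \<partial>TT) \<partial>TT) / (2 * pi)"
    by (subst TT.Fubini_integral[OF *]) simp
  also have "\<dots> = (\<integral>t. pint (\<lambda>_. 1) (complex_of_real r * cis t) * (2 * pi) * f t \<partial>TT) / (2 * pi)"
    unfolding pint_def by (subst pois_sym) simp
  also have "\<dots> = integral\<^sup>L TT f"
    by (simp add: pint_const[OF z])
  finally show "integral\<^sup>L TT (\<lambda>s. pint f (of_real r * cis s)) = integral\<^sup>L TT f" .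
qed

text \<open>One fixed sequence of radii tending to 1, so that dominated convergence applies
  directly.\<close>

definition rad :: "nat \<Rightarrow> real" where
  "rad n = real n / (real n + 1)"

lemma rad: "0 \<le> rad n" "rad n < 1"
  by (auto simp: rad_def)

lemma rad_LIMSEQ: "rad \<longlonglongrightarrow> 1"
  using LIMSEQ_n_over_Suc_n[where 'a = real] by (simp add: rad_def[abs_def] add.commute)

text \<open>The L1 distance between \<open>f\<close> and its Poisson integral on the circle of
  radius \<open>rad n\<close>; mean convergence takes the place of pointwise boundary
  limits.\<close>

definition pdist :: "(real \<Rightarrow> real) \<Rightarrow> nat \<Rightarrow> real" where
  "pdist f n = integral\<^sup>L TT (\<lambda>s. \<bar>pint f (of_real (rad n) * cis s) - f s\<bar>)"

text \<open>The error \<open>f - g\<close> enters twice, once on the circle and once through its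
  Poisson integral, and averaging over the circle preserves the integral of
  \<open>\<bar>f - g\<bar>\<close>.\<close>

lemma pdist_le:
  assumes f: "integrable TT f" and g: "integrable TT g"
  shows "pdist f n \<le> pdist g n + 2 * integral\<^sup>L TT (\<lambda>t. \<bar>f t - g t\<bar>)"
proof -
  let ?z = "\<lambda>s. complex_of_real (rad n) * cis s"
  let ?d = "\<lambda>t. \<bar>f t - g t\<bar>"
  have z: "norm (?z s) < 1" for s using rad[of n] by simp
  have d: "integrable TT ?d" using f g by auto
  have p: "integrable TT (\<lambda>s. pint h (?z s))" if "integrable TT h" for h
    using integrable_pint_circle[OF that rad] .
  have "pdist f n \<le> integral\<^sup>L TT (\<lambda>s. \<bar>pint g (?z s) - g s\<bar> + pint ?d (?z s) + ?d s)"
    unfolding pdist_def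
  proof (rule integral_mono)
    fix s
    have "\<bar>pint f (?z s) - pint g (?z s)\<bar> \<le> pint ?d (?z s)"
      using abs_pint_le[of "\<lambda>t. f t - g t", OF _ z] pint_diff[OF f g z] f g by simp
    then show "\<bar>pint f (?z s) - f s\<bar> \<le> \<bar>pint g (?z s) - g s\<bar> + pint ?d (?z s) + ?d s"
      by linarith
  qed (use f g d p in auto)
  also have "\<dots> = pdist g n + 2 * integral\<^sup>L TT ?d"
    unfolding pdist_def using f g d p integral_pint_circle[OF d rad] by simp
  finally show ?thesis .
qed

lemma pdist_add_le:
  assumes f: "integrable TT f" and g: "integrable TT g"
  shows "pdist (\<lambda>t. f t + g t) n \<le> pdist f n + pdist g n"
proof -
  let ?z = "\<lambda>s. complex_of_real (rad n) * cis s"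
  have z: "norm (?z s) < 1" for s using rad[of n] by simp
  have p: "integrable TT (\<lambda>s. pint h (?z s))" if "integrable TT h" for h
    using integrable_pint_circle[OF that rad] .
  have "pdist (\<lambda>t. f t + g t) n \<le>
      integral\<^sup>L TT (\<lambda>s. \<bar>pint f (?z s) - f s\<bar> + \<bar>pint g (?z s) - g s\<bar>)"
    unfolding pdist_def
  proof (rule integral_mono)
    show "integrable TT (\<lambda>s. \<bar>pint (\<lambda>t. f t + g t) (?z s) - (f s + g s)\<bar>)"
      using p[of "\<lambda>t. f t + g t"] f g by auto
  qed (use f g p in \<open>auto simp: pint_add[OF f g z]\<close>)
  also have "\<dots> = pdist f n + pdist g n"
    unfolding pdist_def using f g p by simp
  finally show ?thesis .
qed

lemma pdist_cmult: "pdist (\<lambda>t. c * f t) n = \<bar>c\<bar> * pdist f n"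
proof -
  have "pdist (\<lambda>t. c * f t) n = integral\<^sup>L TT (\<lambda>s. \<bar>c\<bar> * \<bar>pint f (of_real (rad n) * cis s) - f s\<bar>)"
    unfolding pdist_def pint_cmult by (simp add: abs_mult flip: right_diff_distrib)
  then show ?thesis by (simp add: pdist_def)
qed

lemma pdist_const: "pdist (\<lambda>t. c) n = 0"
proof -
  have "norm (complex_of_real (rad n) * cis s) < 1" for s using rad[of n] by simp
  then show ?thesis unfolding pdist_def by (simp add: pint_const)
qed

lemma pdist_nonneg: "pdist f n \<ge> 0"
  unfolding pdist_def by simp

lemma pdist_LIMSEQ_approx:
  assumes f: "integrable TT f"
    and *: "\<And>k::nat. integrable TT (g k)" "\<And>k. pdist (g k) \<longlonglongrightarrow> 0"
      "(\<lambda>k. integral\<^sup>L TT (\<lambda>t. \<bar>f t - g k t\<bar>)) \<longlonglongrightarrow> 0"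
  shows "pdist f \<longlonglongrightarrow> 0"
proof (rule LIMSEQ_I)
  fix e :: real assume e: "e > 0"
  obtain k where k: "integral\<^sup>L TT (\<lambda>t. \<bar>f t - g k t\<bar>) < e / 4"
    using LIMSEQ_D[OF *(3), of "e/4"] e by force
  obtain N where N: "\<And>n. n \<ge> N \<Longrightarrow> pdist (g k) n < e / 4"
    using LIMSEQ_D[OF *(2)[of k], of "e/4"] e by force
  show "\<exists>N. \<forall>n\<ge>N. norm (pdist f n - 0) < e"
  proof (intro exI[of _ N] allI impI)
    fix n assume "n \<ge> N"
    then show "norm (pdist f n - 0) < e"
      using N[of n] k pdist_le[OF f *(1)[of k], of n] pdist_nonneg[of f n] by simp
  qed
qed

text \<open>\<open>Arg2pi\<close> is continuous off the nonnegative real axis. The angle 0 is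
  excluded because nearby points of the circle may have angles close to \<open>2*pi\<close>.\<close>

lemma cis_near:
  assumes s: "0 < s" "s < 2*pi" and e: "e > 0"
  obtains \<delta> where "\<delta> > 0" "\<And>t. t \<in> {0..<2*pi} \<Longrightarrow> norm (cis t - cis s) < \<delta> \<Longrightarrow> \<bar>t - s\<bar> < e"
proof -
  have A: "Arg2pi (cis t) = t" if "t \<in> {0..<2*pi}" for t
    by (rule Arg2pi_unique[of 1]) (use that in \<open>auto simp: cis_conv_exp\<close>)
  have "cis s \<notin> \<real>\<^sub>\<ge>\<^sub>0"
  proof
    assume "cis s \<in> \<real>\<^sub>\<ge>\<^sub>0"
    then have "Arg2pi (cis s) = 0"
      by (auto simp: Arg2pi_eq_0 complex_nonneg_Reals_iff complex_is_Real_iff)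
    then show False using A[of s] s by simp
  qed
  from continuous_at_Arg2pi[OF this] e obtain \<delta> where "\<delta> > 0"
    "\<And>y. norm (y - cis s) < \<delta> \<Longrightarrow> \<bar>Arg2pi y - Arg2pi (cis s)\<bar> < e"
    unfolding continuous_at_eps_delta dist_norm by (auto simp: dist_real_def)
  then show ?thesis
    using that[of \<delta>] A s by (metis atLeastLessThan_iff less_eq_real_def)
qed

text \<open>Away from \<open>b\<close> and the wrap-around angle 0 the indicator is locally constant
  on the circle, so \<open>pint_near_boundary_value\<close> applies with oscillation 0 and bound 1.
  The two exceptional angles are null, and the constant 2 dominates.\<close>

lemma pdist_indicator_atMost: "pdist (indicator {..b}) \<longlonglongrightarrow> 0"
proof -
  let ?f = "indicator {..b} :: real \<Rightarrow> real"
  have m: "?f \<in> borel_measurable TT" by (rule measurable_TT_I) simp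
  have i: "integrable TT ?f" by (rule integrable_TT_bounded[of _ 1]) (use m in \<open>auto split: split_indicator\<close>)
  have p: "integrable TT (\<lambda>s. pint ?f (of_real (rad n) * cis s))" for n
    using integrable_pint_circle[OF i rad] .
  have "(\<lambda>n. integral\<^sup>L TT (\<lambda>s. \<bar>pint ?f (of_real (rad n) * cis s) - ?f s\<bar>)) \<longlonglongrightarrow> integral\<^sup>L TT (\<lambda>s. 0::real)"
  proof (rule integral_dominated_convergence[where w = "\<lambda>_. 2"])
    have "AE s in TT. s \<noteq> 0 \<and> s \<noteq> b"
      unfolding TT_def by (subst AE_restrict_space_iff)
        (use AE_lborel_singleton[of 0] AE_lborel_singleton[of b] in auto)
    moreover have "AE s in TT. s \<in> {0..<2*pi}"
      by (rule AE_I2) simp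
    ultimately show "AE s in TT. (\<lambda>n. \<bar>pint ?f (of_real (rad n) * cis s) - ?f s\<bar>) \<longlonglongrightarrow> 0"
    proof eventually_elim
      fix s assume s: "s \<noteq> 0 \<and> s \<noteq> b" and s': "s \<in> {0..<2*pi}"
      then obtain \<delta> where d: "\<delta> > 0"
        "\<And>t. t \<in> {0..<2*pi} \<Longrightarrow> norm (cis t - cis s) < \<delta> \<Longrightarrow> \<bar>t - s\<bar> < \<bar>s - b\<bar>"
        using cis_near[of s "\<bar>s - b\<bar>"] by auto
      have ev: "\<forall>\<^sub>F n in sequentially. \<bar>pint ?f (of_real (rad n) * cis s) - ?f s\<bar> \<le> 8 * (1 - (rad n)\<^sup>2) / \<delta>\<^sup>2"
      proof -
        have "\<forall>\<^sub>F n in sequentially. rad n > 1 - \<delta> / 2"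
          by (rule order_tendstoD(1)[OF rad_LIMSEQ]) (use d in simp)
        then show ?thesis
        proof eventually_elim
          case (elim n)
          have "\<bar>pint ?f (of_real (rad n) * cis s) - ?f s\<bar> \<le> 0 + 8 * 1 * (1 - (rad n)\<^sup>2) / \<delta>\<^sup>2"
          proof (rule pint_near_boundary_value[OF m])
            show "\<bar>?f t - ?f s\<bar> \<le> 0" if "t \<in> {0..<2*pi}" "norm (cis t - cis s) < \<delta>" for t
              using d(2)[OF that] by (auto split: split_indicator)
          qed (use elim d rad[of n] in \<open>auto split: split_indicator\<close>)
          then show ?case by simp
        qed
      qed
      have "(\<lambda>n. 8 * (1 - (rad n)\<^sup>2) / \<delta>\<^sup>2) \<longlonglongrightarrow> 8 * (1 - 1\<^sup>2) / \<delta>\<^sup>2"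
        by (intro tendsto_intros rad_LIMSEQ) (use d in auto)
      then show "(\<lambda>n. \<bar>pint ?f (of_real (rad n) * cis s) - ?f s\<bar>) \<longlonglongrightarrow> 0"
        by (intro tendsto_sandwich[OF _ ev tendsto_const]) auto
    qed
    show "AE s in TT. norm \<bar>pint ?f (of_real (rad n) * cis s) - ?f s\<bar> \<le> 2" for n
    proof (rule AE_I2)
      fix s
      have z: "norm (complex_of_real (rad n) * cis s) < 1" using rad[of n] by simp
      have "\<bar>pint ?f (of_real (rad n) * cis s)\<bar> \<le> pint (\<lambda>t. \<bar>?f t\<bar>) (of_real (rad n) * cis s)"
        by (rule abs_pint_le[OF i z])
      also have "\<dots> \<le> pint (\<lambda>t. 1) (of_real (rad n) * cis s)"
        by (rule pint_mono_AE[OF integrable_abs[OF i] integrable_TT_const z]) (auto split: split_indicator)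
      also have "\<dots> = 1" by (rule pint_const[OF z])
      finally show "norm \<bar>pint ?f (of_real (rad n) * cis s) - ?f s\<bar> \<le> 2"
        by (auto split: split_indicator)
    qed
  qed (use p m integrable_TT_const in \<open>auto\<close>)
  then show ?thesis unfolding pdist_def by simp
qed

text \<open>A pi-lambda argument starting from the half-lines \<open>{..b}\<close>. Complements
  follow from subadditivity, since constants have distance 0; disjoint unions follow by L1
  approximation with finite unions.\<close>

lemma pdist_indicator:
  fixes A :: "real set"
  assumes "A \<in> sets borel"
  shows "pdist (indicator A) \<longlonglongrightarrow> 0"
proof -
  have i: "integrable TT (indicator A :: real \<Rightarrow> real)" if "A \<in> sets borel" for A :: "real set"
    by (rule integrable_TT_bounded[of _ 1]) (use that in \<open>auto intro!: measurable_TT_I split: split_indicator\<close>)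
  have "Int_stable (range (\<lambda>a::real. {..a}))"
    by (auto simp: Int_stable_def)
  moreover have "range (\<lambda>a::real. {..a}) \<subseteq> Pow UNIV" by auto
  moreover have "A \<in> sigma_sets UNIV (range (\<lambda>a::real. {..a}))"
    using assms by (simp add: borel_eq_atMost)
  ultimately show ?thesis
  proof (induction rule: sigma_sets_induct_disjoint)
    case (basic A)
    then show ?case using pdist_indicator_atMost by auto
  next
    case empty
    have "(indicator {} :: real \<Rightarrow> real) = (\<lambda>_. 0)" by auto
    then show ?case by (simp add: pdist_const[of 0, abs_def] )
  next
    case (compl A)
    then have A: "A \<in> sets borel" by (simp add: borel_eq_atMost)
    have eq: "(indicator (UNIV - A) :: real \<Rightarrow> real) = (\<lambda>t. 1 + (-1) * indicator A t)"
      by (auto simp: fun_eq_iff split: split_indicator)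
    have "pdist (indicator (UNIV - A)) n \<le> pdist (indicator A) n" for n
      unfolding eq using pdist_add_le[of "\<lambda>_. 1" "\<lambda>t. (-1) * indicator A t" n, OF integrable_TT_const]
        pdist_const[of 1 n] pdist_cmult[of "-1" "indicator A" n] i[OF A] by simp
    then show ?case
      by (intro LIMSEQ_squeeze_0[OF pdist_nonneg _ compl(2)])
  next
    case (union F)
    have F: "F k \<in> sets borel" for k using union(2) by (auto simp: borel_eq_atMost)
    let ?g = "\<lambda>k t. \<Sum>j<k. indicator (F j) t :: real"
    have eq: "?g k t = indicator (\<Union>j<k. F j) t" for k t
      by (subst indicator_UN_disjoint) (use union(1) in \<open>auto simp: disjoint_family_on_def\<close>)
    show ?case
    proof (rule pdist_LIMSEQ_approx[where g = ?g])
      show "integrable TT (?g k)" for k using i F by auto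
      show "pdist (?g k) \<longlonglongrightarrow> 0" for k
      proof (induction k)
        case 0
        then show ?case by (simp add: pdist_const[of 0, abs_def])
      next
        case (Suc k)
        have "pdist (?g (Suc k)) n \<le> pdist (?g k) n + pdist (indicator (F k)) n" for n
          using pdist_add_le[of "?g k" "indicator (F k)" n] i F by simp
        then show ?case
          using tendsto_add[OF Suc union(3)[of k]]
          by (intro LIMSEQ_squeeze_0[OF pdist_nonneg]) auto
      qed
      have UF: "(\<Union>j. F j) \<in> sets borel" "(\<Union>j<k. F j) \<in> sets borel" for k using F by auto
      have "(\<lambda>k. \<integral>t. \<bar>indicator (\<Union>j. F j) t - ?g k t\<bar> \<partial>TT) \<longlonglongrightarrow> integral\<^sup>L TT (\<lambda>t. 0::real)"
      proof (rule integral_dominated_convergence[where w = "\<lambda>_. 2"])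
        show "AE t in TT. (\<lambda>k. \<bar>indicator (\<Union>j. F j) t - ?g k t\<bar>) \<longlonglongrightarrow> 0"
        proof (rule AE_I2)
          fix t
          show "(\<lambda>k. \<bar>indicator (\<Union>j. F j) t - ?g k t\<bar>) \<longlonglongrightarrow> 0"
          proof (cases "t \<in> (\<Union>j. F j)")
            case True
            then obtain j where j: "t \<in> F j" by auto
            have "\<forall>\<^sub>F k in sequentially. \<bar>indicator (\<Union>j. F j) t - ?g k t\<bar> = 0"
              using eventually_gt_at_top[of j]
              by eventually_elim (use j True in \<open>auto simp: eq split: split_indicator\<close>)
            then show ?thesis by (rule tendsto_eventually)
          next
            case False
            then show ?thesis by simp
          qed
        qed
      qed (use UF integrable_TT_const in \<open>auto simp: eq intro!: measurable_TT_I split: split_indicator\<close>)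
      then show "(\<lambda>k. \<integral>t. \<bar>indicator (\<Union>j. F j) t - ?g k t\<bar> \<partial>TT) \<longlonglongrightarrow> 0" by simp
    qed (use i F in auto)
  qed
qed

theorem pdist_LIMSEQ:
  assumes "integrable TT f"
  shows "pdist f \<longlonglongrightarrow> 0"
  using assms
proof (induction rule: integrable_induct)
  case (base A c)
  then have "A \<in> sets borel" by (auto simp: TT_def sets_restrict_space)
  from tendsto_mult_right_zero[OF pdist_indicator[OF this], of "\<bar>c\<bar>"]
  show ?case
    using pdist_cmult[of c "indicator A"] by (simp add: mult.commute[of _ c])
next
  case (add f g)
  show ?case
    using tendsto_add[OF add.IH] pdist_add_le[OF add.hyps]
    by (intro LIMSEQ_squeeze_0[OF pdist_nonneg]) auto
next
  case (lim f s)
  show ?case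
  proof (rule pdist_LIMSEQ_approx[OF lim.hyps(4,1) lim.IH])
    have "(\<lambda>k. \<integral>t. \<bar>f t - s k t\<bar> \<partial>TT) \<longlonglongrightarrow> integral\<^sup>L TT (\<lambda>t. 0::real)"
    \<comment> \<open>The induction rule supplies approximants with |s k t| \<le> 2 |f t|, so the
      difference is at most 3 |f t|.\<close>
    proof (rule integral_dominated_convergence[where w = "\<lambda>t. 3 * norm (f t)"])
      show "AE t in TT. (\<lambda>k. \<bar>f t - s k t\<bar>) \<longlonglongrightarrow> 0"
      proof (rule AE_I2)
        fix t assume "t \<in> space TT"
        from tendsto_diff[OF tendsto_const lim.hyps(2)[OF this], of "f t"]
        show "(\<lambda>k. \<bar>f t - s k t\<bar>) \<longlonglongrightarrow> 0"
          using tendsto_rabs_zero by fastforce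
      qed
      show "AE t in TT. norm \<bar>f t - s k t\<bar> \<le> 3 * norm (f t)" for k
      proof (rule AE_I2)
        fix t assume "t \<in> space TT"
        from lim.hyps(3)[OF this, of k] show "norm \<bar>f t - s k t\<bar> \<le> 3 * norm (f t)"
          by (simp add: abs_if split: if_splits)
      qed
    qed (use lim.hyps(1,4) in auto)
    then show "(\<lambda>k. \<integral>t. \<bar>f t - s k t\<bar> \<partial>TT) \<longlonglongrightarrow> 0" by simp
  qed
qed

text \<open>Where \<open>f\<close> is negative, a nonnegative Poisson integral misses it by at least
  its negative part. The integral of the negative part is thus below every
  \<open>pdist f n\<close>.\<close>

lemma nonneg_AE_if_pint_nonneg:
  assumes f: "integrable TT f" and p: "\<And>z. norm z < 1 \<Longrightarrow> pint f z \<ge> 0"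
  shows "AE t in TT. f t \<ge> 0"
proof -
  define g where "g t = max 0 (- f t)" for t
  have g: "integrable TT g" unfolding g_def using f by auto
  have "integral\<^sup>L TT g \<le> pdist f n" for n
    unfolding pdist_def
  proof (rule integral_mono[OF g])
    show "integrable TT (\<lambda>s. \<bar>pint f (complex_of_real (rad n) * cis s) - f s\<bar>)"
      using integrable_pint_circle[OF f rad] f by auto
    show "g s \<le> \<bar>pint f (complex_of_real (rad n) * cis s) - f s\<bar>" for s
      using p[of "complex_of_real (rad n) * cis s"] rad[of n] by (auto simp: g_def)
  qed
  then have "integral\<^sup>L TT g \<le> 0"
    using LIMSEQ_le_const[OF pdist_LIMSEQ[OF f]] by blast
  moreover have "integral\<^sup>L TT g \<ge> 0" by (rule integral_nonneg_AE) (auto simp: g_def)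
  ultimately have "AE t in TT. g t = 0"
    using integral_nonneg_eq_0_iff_AE[OF g] by (auto simp: g_def)
  then show ?thesis by eventually_elim (auto simp: g_def max_def split: if_splits)
qed

text \<open>Both f and conj f have vanishing Herglotz integrals, so every Re (a f) has Poisson
  integral 0 and is nonnegative a.e. Taking a = 1, -1, i, -i leaves only 0.\<close>

lemma AE_zero_if_fcoeff_zero:
  assumes f: "integrable TT f" and c: "\<And>n. fcoeff f n = 0"
  shows "AE t in TT. f t = 0"
proof -
  have h: "integral\<^sup>L TT (\<lambda>t. hkernel z t * g t) = 0"
    if "integrable TT g" "\<And>n. fcoeff g (int n) = 0" "norm z < 1" for z and g :: "real \<Rightarrow> complex"
    using sums_unique[OF integral_hkernel_sums[OF that(1,3)]] by (simp add: that(2))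
  have cn: "fcoeff (\<lambda>t. cnj (f t)) n = 0" for n
    by (simp add: fcoeff_cnj c)
  have z: "pint (\<lambda>t. Re (a * f t)) z = 0" if z: "norm z < 1" for z a
  proof -
    have 0: "integral\<^sup>L TT (\<lambda>t. hkernel z t * (a * f t + cnj (a * f t))) = 0"
    proof -
      have i1: "integrable TT (\<lambda>t. hkernel z t * f t)" "integrable TT (\<lambda>t. hkernel z t * cnj (f t))"
        using integrable_hkernel_mult[OF _ z] f by auto
      have "integral\<^sup>L TT (\<lambda>t. hkernel z t * (a * f t + cnj (a * f t))) =
         integral\<^sup>L TT (\<lambda>t. a * (hkernel z t * f t) + cnj a * (hkernel z t * cnj (f t)))"
        by (simp add: algebra_simps)
      also have "\<dots> = 0"
        using i1 h[OF f _ z] h[of "\<lambda>t. cnj (f t)", OF _ _ z] f c cn by simp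
      finally show ?thesis .
    qed
    have "herg (\<lambda>t. Re (a * f t)) z = 0"
    proof -
      have "(\<lambda>t. hkernel z t * complex_of_real (Re (a * f t))) =
        (\<lambda>t. (1/2) * (hkernel z t * (a * f t + cnj (a * f t))))"
        by (rule ext, subst complex_add_cnj) simp
      then show ?thesis unfolding herg_def using 0 by (simp del: complex_add_cnj)
    qed
    moreover have "integrable TT (\<lambda>t. Re (a * f t))" using f by auto
    ultimately show ?thesis using Re_herg[OF _ z] by fastforce
  qed
  have "AE t in TT. Re (a * f t) \<ge> 0" for a
    by (rule nonneg_AE_if_pint_nonneg) (use f z in auto)
  from this[of 1] this[of "-1"] this[of \<i>] this[of "- \<i>"]
  show ?thesis by eventually_elim (simp add: complex_eq_iff)
qed

subsection \<open>Fourier coefficients of square integrable functions\<close>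

text \<open>The squared norm is not normalised: the circle has mass \<open>2*pi\<close>, whence the
  factors \<open>2*pi\<close> below.\<close>

abbreviation nsq :: "(real \<Rightarrow> complex) \<Rightarrow> real" where
  "nsq f \<equiv> integral\<^sup>L TT (\<lambda>t. (cmod (f t))\<^sup>2)"

lemma Cauchy_Schwarz_integral:
  fixes u v :: "'a \<Rightarrow> real"
  assumes m: "u \<in> borel_measurable M" "v \<in> borel_measurable M"
    and u: "integrable M (\<lambda>x. (u x)\<^sup>2)" and v: "integrable M (\<lambda>x. (v x)\<^sup>2)"
  shows "integrable M (\<lambda>x. u x * v x)"
    and "(integral\<^sup>L M (\<lambda>x. u x * v x))\<^sup>2 \<le> integral\<^sup>L M (\<lambda>x. (u x)\<^sup>2) * integral\<^sup>L M (\<lambda>x. (v x)\<^sup>2)"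
proof -
  show uv: "integrable M (\<lambda>x. u x * v x)"
  proof (rule Bochner_Integration.integrable_bound[OF Bochner_Integration.integrable_add[OF u v]])
    show "AE x in M. norm (u x * v x) \<le> norm ((u x)\<^sup>2 + (v x)\<^sup>2)"
    proof (rule AE_I2)
      fix x
      have "2 * (\<bar>u x\<bar> * \<bar>v x\<bar>) \<le> (u x)\<^sup>2 + (v x)\<^sup>2"
        using sum_squares_bound[of "\<bar>u x\<bar>" "\<bar>v x\<bar>"] by simp
      moreover have "0 \<le> \<bar>u x\<bar> * \<bar>v x\<bar>" by simp
      ultimately have "\<bar>u x\<bar> * \<bar>v x\<bar> \<le> (u x)\<^sup>2 + (v x)\<^sup>2" by linarith
      then show "norm (u x * v x) \<le> norm ((u x)\<^sup>2 + (v x)\<^sup>2)"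
        by (simp add: abs_mult)
    qed
  qed (use m in measurable)
  define A B C where "A = integral\<^sup>L M (\<lambda>x. (u x)\<^sup>2)" "B = integral\<^sup>L M (\<lambda>x. u x * v x)"
    "C = integral\<^sup>L M (\<lambda>x. (v x)\<^sup>2)"
  \<comment> \<open>Expanding the square gives a nonnegative quadratic in \<open>l\<close>; its
    minimiser \<open>B / C\<close> yields the inequality when \<open>C > 0\<close>.\<close>
  have q: "0 \<le> A - 2 * l * B + l\<^sup>2 * C" for l
  proof -
    have "0 \<le> integral\<^sup>L M (\<lambda>x. (u x - l * v x)\<^sup>2)" by simp
    also have "\<dots> = integral\<^sup>L M (\<lambda>x. (u x)\<^sup>2 - (2 * l) * (u x * v x) + l\<^sup>2 * (v x)\<^sup>2)"
      by (intro Bochner_Integration.integral_cong) (auto simp: power2_eq_square algebra_simps)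
    also have "\<dots> = A - 2 * l * B + l\<^sup>2 * C"
      using u v uv by (simp add: A_B_C_def)
    finally show ?thesis .
  qed
  have "C \<ge> 0" by (simp add: A_B_C_def)
  have "B\<^sup>2 \<le> A * C"
  proof (cases "C = 0")
    case True
    have "B = 0"
    proof (rule ccontr)
      assume "B \<noteq> 0"
      \<comment> \<open>With \<open>C = 0\<close> the quadratic is linear, and this \<open>l\<close>
        gives it the value -1.\<close>
      then show False using q[of "(A + 1) / (2 * B)"] True by (simp add: field_simps)
    qed
    then show ?thesis using True by simp
  next
    case False
    with \<open>C \<ge> 0\<close> have "C > 0" by simp
    have "0 \<le> A - B\<^sup>2 / C"
      using q[of "B / C"] \<open>C > 0\<close> by (simp add: field_simps power2_eq_square)
    then show ?thesis using \<open>C > 0\<close> by (simp add: field_simps)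
  qed
  then show "(integral\<^sup>L M (\<lambda>x. u x * v x))\<^sup>2 \<le> integral\<^sup>L M (\<lambda>x. (u x)\<^sup>2) * integral\<^sup>L M (\<lambda>x. (v x)\<^sup>2)"
    by (simp add: A_B_C_def)
qed

section \<open>The space of square integrable functions\<close>

lemma L2_measurable: "L2 f \<Longrightarrow> f \<in> borel_measurable TT"
  by (simp add: L2_def)

lemma H2_L2: "H2 f \<Longrightarrow> L2 f"
  by (simp add: H2_def)

lemma integral_norm_mult_le:
  assumes "L2 f" "L2 g"
  shows "integral\<^sup>L TT (\<lambda>t. norm (f t * g t)) \<le> sqrt (nsq f * nsq g)"
  using Cauchy_Schwarz_integral(2)[of "\<lambda>t. norm (f t)" TT "\<lambda>t. norm (g t)"] assms
  unfolding L2_def by (auto simp: norm_mult intro!: real_le_rsqrt)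

lemma L2_mult_integrable:
  assumes "L2 f" "L2 g"
  shows "integrable TT (\<lambda>t. f t * g t)"
proof (rule Bochner_Integration.integrable_bound)
  show "integrable TT (\<lambda>t. norm (f t) * norm (g t))"
    by (rule Cauchy_Schwarz_integral(1)) (use assms in \<open>auto simp: L2_def\<close>)
qed (use assms in \<open>auto simp: L2_def norm_mult\<close>)

lemma L2_bounded:
  assumes "f \<in> borel_measurable TT" "\<And>t. norm (f t) \<le> B"
  shows "L2 f"
proof -
  have "norm ((norm (f t))\<^sup>2) \<le> B\<^sup>2" for t
    using assms(2)[of t] by (simp add: power_mono)
  then show ?thesis
    unfolding L2_def using assms(1) by (auto intro!: integrable_TT_bounded[of _ "B\<^sup>2"])
qed

lemma L2_integrable: "L2 f \<Longrightarrow> integrable TT f"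
  using L2_mult_integrable[of f "\<lambda>_. 1"] L2_bounded[of "\<lambda>_. 1" 1] by simp

lemma L2_cmult: "L2 f \<Longrightarrow> L2 (\<lambda>t. c * f t)"
  unfolding L2_def by (auto simp: norm_mult power_mult_distrib)

lemma cnj_measurable [measurable]: "cnj \<in> borel_measurable borel"
  by (intro borel_measurable_continuous_onI continuous_intros)

lemma L2_cnj: "L2 f \<Longrightarrow> L2 (\<lambda>t. cnj (f t))"
  unfolding L2_def by auto

lemma L2_add:
  assumes "L2 f" "L2 g"
  shows "L2 (\<lambda>t. f t + g t)"
proof -
  have [measurable]: "f \<in> borel_measurable TT" "g \<in> borel_measurable TT"
    using assms by (auto simp: L2_def)
  have "integrable TT (\<lambda>t. (norm (f t + g t))\<^sup>2)"
  proof (rule Bochner_Integration.integrable_bound)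
    show "integrable TT (\<lambda>t. 2 * (norm (f t))\<^sup>2 + 2 * (norm (g t))\<^sup>2)"
      using assms by (auto simp: L2_def)
    show "AE t in TT. norm ((norm (f t + g t))\<^sup>2) \<le> norm (2 * (norm (f t))\<^sup>2 + 2 * (norm (g t))\<^sup>2)"
    proof (rule AE_I2)
      fix t
      have "(norm (f t + g t))\<^sup>2 \<le> (norm (f t) + norm (g t))\<^sup>2"
        by (intro power_mono norm_triangle_ineq) auto
      also have "\<dots> \<le> 2 * (norm (f t))\<^sup>2 + 2 * (norm (g t))\<^sup>2"
        using sum_squares_bound[of "norm (f t)" "norm (g t)"] by (simp add: power2_sum)
      finally show "norm ((norm (f t + g t))\<^sup>2) \<le> norm (2 * (norm (f t))\<^sup>2 + 2 * (norm (g t))\<^sup>2)"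
        by simp
    qed
  qed measurable
  then show ?thesis by (simp add: L2_def)
qed

lemma L2_diff: "L2 f \<Longrightarrow> L2 g \<Longrightarrow> L2 (\<lambda>t. f t - g t)"
  using L2_add[of f "\<lambda>t. - 1 * g t"] L2_cmult[of g "-1"] by simp

lemma L2_cong_AE:
  assumes "L2 f" "g \<in> borel_measurable TT" "AE t in TT. norm (f t) = norm (g t)"
  shows "L2 g"
proof -
  have "AE t in TT. (norm (f t))\<^sup>2 = (norm (g t))\<^sup>2" using assms(3) by eventually_elim simp
  then show ?thesis
    using assms integrable_cong_AE[of "\<lambda>t. (norm (f t))\<^sup>2" TT "\<lambda>t. (norm (g t))\<^sup>2"]
    unfolding L2_def by auto
qed

lemma H2_cong_AE:
  assumes "H2 f" "g \<in> borel_measurable TT" "AE t in TT. f t = g t"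
  shows "H2 g"
proof -
  have "L2 g" by (rule L2_cong_AE[OF H2_L2[OF assms(1)] assms(2)]) (use assms(3) in eventually_elim, simp)
  moreover have "fcoeff g n = fcoeff f n" for n
    by (rule fcoeff_cong_AE) (use assms in \<open>auto simp: H2_def L2_def\<close>)
  ultimately show ?thesis using assms(1) by (simp add: H2_def)
qed

lemma integral_norm_le_sqrt_nsq:
  assumes "L2 f"
  shows "integral\<^sup>L TT (\<lambda>t. norm (f t)) \<le> sqrt (2 * pi * nsq f)"
  using integral_norm_mult_le[OF assms L2_bounded[of "\<lambda>_. 1" 1]] by (simp add: mult.commute[of "nsq f"])

section \<open>Analytic trigonometric polynomials, Bessel, Riesz-Fischer and Parseval\<close>

definition tpoly :: "(nat \<Rightarrow> complex) \<Rightarrow> nat \<Rightarrow> real \<Rightarrow> complex" where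
  "tpoly c N t = (\<Sum>n<N. c n * cis (of_int (int n) * t))"

lemma tpoly_measurable [measurable]: "tpoly c N \<in> borel_measurable TT"
  unfolding tpoly_def by measurable

lemma norm_tpoly_le: "norm (tpoly c N t) \<le> (\<Sum>n<N. norm (c n))"
  unfolding tpoly_def by (rule order_trans[OF norm_sum]) (simp add: norm_mult)

lemma tpoly_L2: "L2 (tpoly c N)"
  by (rule L2_bounded[OF tpoly_measurable norm_tpoly_le])

lemma fcoeff_tpoly_mult:
  assumes "integrable TT f"
  shows "fcoeff (\<lambda>t. tpoly c N t * f t) k = (\<Sum>n<N. c n * fcoeff f (k - int n))"
proof -
  have "integral\<^sup>L TT (\<lambda>t. tpoly c N t * f t * cis (- (of_int k * t))) =
    integral\<^sup>L TT (\<lambda>t. \<Sum>n<N. c n * (f t * cis (- (of_int (k - int n) * t))))"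
    unfolding tpoly_def sum_distrib_right
    by (intro Bochner_Integration.integral_cong refl sum.cong) (auto simp: cis_mult algebra_simps)
  also have "\<dots> = (\<Sum>n<N. c n * integral\<^sup>L TT (\<lambda>t. f t * cis (- (of_int (k - int n) * t))))"
    by (subst Bochner_Integration.integral_sum)
       (auto intro!: integrable_mult_right integrable_mult_cis[OF assms] simp del: of_int_diff of_int_of_nat_eq)
  finally show ?thesis unfolding fcoeff_def by (simp add: sum_divide_distrib)
qed

lemma fcoeff_tpoly: "fcoeff (tpoly c N) k = (if 0 \<le> k \<and> k < int N then c (nat k) else 0)"
proof -
  have "fcoeff (tpoly c N) k = (\<Sum>n<N. c n * fcoeff (\<lambda>t. cis (of_int 0 * t)) (k - int n))"
    using fcoeff_tpoly_mult[of "\<lambda>_. 1" c N k, OF integrable_TT_const] by simp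
  also have "\<dots> = (\<Sum>n<N. if int n = k then c n else 0)"
    unfolding fcoeff_cis by (intro sum.cong) auto
  also have "\<dots> = (if 0 \<le> k \<and> k < int N then c (nat k) else 0)"
  proof (cases "0 \<le> k \<and> k < int N")
    case True
    then have "(\<Sum>n<N. if int n = k then c n else 0) = (\<Sum>n<N. if n = nat k then c n else 0)"
      by (intro sum.cong) auto
    with True show ?thesis by auto
  qed (auto intro!: sum.neutral)
  finally show ?thesis .
qed

lemma integral_mult_cnj_tpoly:
  assumes "integrable TT f"
  shows "integral\<^sup>L TT (\<lambda>t. f t * cnj (tpoly c N t)) = 2 * pi * (\<Sum>n<N. fcoeff f (int n) * cnj (c n))"
proof -
  have "integral\<^sup>L TT (\<lambda>t. f t * cnj (tpoly c N t)) =
    integral\<^sup>L TT (\<lambda>t. \<Sum>n<N. cnj (c n) * (f t * cis (- (of_int (int n) * t))))"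
    unfolding tpoly_def cnj_sum sum_distrib_left
    by (intro Bochner_Integration.integral_cong refl sum.cong) (auto simp: cis_cnj)
  also have "\<dots> = (\<Sum>n<N. cnj (c n) * integral\<^sup>L TT (\<lambda>t. f t * cis (- (of_int (int n) * t))))"
    by (subst Bochner_Integration.integral_sum)
       (auto intro!: integrable_mult_right integrable_mult_cis[OF assms] simp del: of_int_of_nat_eq)
  also have "\<dots> = 2 * pi * (\<Sum>n<N. fcoeff f (int n) * cnj (c n))"
    unfolding sum_distrib_left fcoeff_def by (intro sum.cong) auto
  finally show ?thesis .
qed

text \<open>Pythagoras: by orthogonality the inner product of \<open>f\<close> with the partial sum
  equals the squared norm of the partial sum, so -2 times the one plus the other leaves -1. Bessel
  and Parseval both come from this identity.\<close>

lemma nsq_diff_tpoly: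
  assumes f: "L2 f"
  shows "nsq (\<lambda>t. f t - tpoly (\<lambda>n. fcoeff f (int n)) N t) = nsq f - 2 * pi * (\<Sum>n<N. (norm (fcoeff f (int n)))\<^sup>2)"
proof -
  let ?c = "\<lambda>n. fcoeff f (int n)"
  let ?S = "tpoly ?c N"
  have S: "L2 ?S" by (rule tpoly_L2)
  have i: "integrable TT f" "integrable TT ?S" using f S by (auto intro: L2_integrable)
  have ii: "integrable TT (\<lambda>t. f t * cnj (?S t))" "integrable TT (\<lambda>t. ?S t * cnj (?S t))"
    by (intro L2_mult_integrable f S L2_cnj)+
  have e: "complex_of_real (2 * pi) * (\<Sum>n<N. ?c n * cnj (?c n)) = complex_of_real (2 * pi * (\<Sum>n<N. (norm (?c n))\<^sup>2))"
    by (simp flip: complex_norm_square)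
  have "nsq (\<lambda>t. f t - ?S t) = integral\<^sup>L TT (\<lambda>t. (norm (f t))\<^sup>2 - 2 * Re (f t * cnj (?S t)) + Re (?S t * cnj (?S t)))"
    by (intro Bochner_Integration.integral_cong refl)
       (simp only: cmod_power2, simp add: power2_eq_square algebra_simps)
  also have "\<dots> = nsq f - 2 * Re (integral\<^sup>L TT (\<lambda>t. f t * cnj (?S t))) + Re (integral\<^sup>L TT (\<lambda>t. ?S t * cnj (?S t)))"
  proof -
    have j: "integrable TT (\<lambda>t. (norm (f t))\<^sup>2)" using f by (simp add: L2_def)
    show ?thesis
      using j integrable_Re[OF ii(1)] integrable_Re[OF ii(2)]
      unfolding integral_Re[OF ii(1), symmetric] integral_Re[OF ii(2), symmetric]
      by (simp del: complex_mult_cnj times_complex.sel)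
  qed
  also have "\<dots> = nsq f - 2 * pi * (\<Sum>n<N. (norm (?c n))\<^sup>2)"
    unfolding integral_mult_cnj_tpoly[OF i(1)] integral_mult_cnj_tpoly[OF i(2)]
    by (subst (2) sum.cong[OF refl, of _ _ "\<lambda>n. ?c n * cnj (?c n)"])
       (simp add: fcoeff_tpoly, simp only: e Re_complex_of_real)
  finally show ?thesis .
qed

text \<open>A polynomial is its own partial sum, so the left-hand side of
  \<open>nsq_diff_tpoly\<close> is 0.\<close>

lemma nsq_tpoly: "nsq (tpoly c N) = 2 * pi * (\<Sum>n<N. (norm (c n))\<^sup>2)"
proof -
  have "tpoly (\<lambda>n. fcoeff (tpoly c N) (int n)) N = tpoly c N"
    unfolding fun_eq_iff tpoly_def[of "\<lambda>n. fcoeff (tpoly c N) (int n)"] tpoly_def[of c N, symmetric]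
    by (auto simp: fcoeff_tpoly tpoly_def[of c] intro!: sum.cong simp flip: tpoly_def[of c N, abs_def])
  moreover have "(\<Sum>n<N. (norm (fcoeff (tpoly c N) (int n)))\<^sup>2) = (\<Sum>n<N. (norm (c n))\<^sup>2)"
    by (intro sum.cong) (auto simp: fcoeff_tpoly)
  ultimately show ?thesis using nsq_diff_tpoly[OF tpoly_L2, of c N N] by simp
qed

lemma nsq_tpoly_diff:
  assumes "M \<le> N"
  shows "nsq (\<lambda>t. tpoly c N t - tpoly c M t) = 2 * pi * (\<Sum>n=M..<N. (norm (c n))\<^sup>2)"
proof -
  have s: "(\<Sum>n<N. if n < M then 0 else h n) = (\<Sum>n=M..<N. h n)" for h :: "nat \<Rightarrow> 'b::comm_monoid_add"
    by (rule sum.mono_neutral_cong_right) auto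
  have "tpoly c N t - tpoly c M t = tpoly (\<lambda>n. if n < M then 0 else c n) N t" for t
  proof -
    have "tpoly (\<lambda>n. if n < M then 0 else c n) N t = (\<Sum>n=M..<N. c n * cis (of_int (int n) * t))"
      unfolding tpoly_def s[symmetric] by (intro sum.cong) auto
    then show ?thesis
      unfolding tpoly_def using assms
      by (simp add: sum_diff_nat_ivl lessThan_atLeast0)
  qed
  moreover have "(\<Sum>n<N. (norm (if n < M then 0 else c n))\<^sup>2) = (\<Sum>n=M..<N. (norm (c n))\<^sup>2)"
    unfolding s[symmetric] by (intro sum.cong) auto
  ultimately show ?thesis by (simp add: nsq_tpoly)
qed

lemma Bessel_summable:
  assumes "L2 f"
  shows "summable (\<lambda>n. (norm (fcoeff f (int n)))\<^sup>2)"
proof (rule summableI_nonneg_bounded)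
  fix N
  have "0 \<le> nsq f - 2 * pi * (\<Sum>n<N. (norm (fcoeff f (int n)))\<^sup>2)"
    unfolding nsq_diff_tpoly[OF assms, symmetric] by simp
  then show "(\<Sum>n<N. (norm (fcoeff f (int n)))\<^sup>2) \<le> nsq f / (2*pi)"
    by (simp add: field_simps)
qed auto

text \<open>Fatou's lemma for real integrals, delivering integrability of the limit as well. It
  serves the completeness argument and the passage to the logarithm.\<close>

lemma Fatou_bound:
  fixes u :: "nat \<Rightarrow> 'a \<Rightarrow> real"
  assumes u: "\<And>k. integrable M (u k)" "\<And>k x. 0 \<le> u k x" "\<forall>\<^sub>F k in sequentially. integral\<^sup>L M (u k) \<le> B"
    and v: "v \<in> borel_measurable M" "\<And>x. 0 \<le> v x" "AE x in M. (\<lambda>k. u k x) \<longlonglongrightarrow> v x"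
  shows "integrable M v" "integral\<^sup>L M v \<le> B"
proof -
  have [measurable]: "u k \<in> borel_measurable M" for k using u(1) by auto
  note v(1)[measurable]
  from u(3) obtain k0 where k0: "integral\<^sup>L M (u k0) \<le> B" by (auto simp: eventually_sequentially)
  have "0 \<le> integral\<^sup>L M (u k0)" using u(2) by simp
  with k0 have B: "B \<ge> 0" by linarith
  have "(\<integral>\<^sup>+x. ennreal (v x) \<partial>M) = (\<integral>\<^sup>+x. liminf (\<lambda>k. ennreal (u k x)) \<partial>M)"
  proof (rule nn_integral_cong_AE)
    show "AE x in M. ennreal (v x) = liminf (\<lambda>k. ennreal (u k x))"
      using v(3)
    proof eventually_elim
      case (elim x)
      then have "(\<lambda>k. ennreal (u k x)) \<longlonglongrightarrow> ennreal (v x)" by (rule tendsto_ennrealI)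
      then show ?case by (simp add: lim_imp_Liminf)
    qed
  qed
  also have "\<dots> \<le> liminf (\<lambda>k. \<integral>\<^sup>+x. ennreal (u k x) \<partial>M)"
    by (rule nn_integral_liminf) auto
  also have "\<dots> \<le> ennreal B"
  proof (rule Liminf_le)
    show "\<forall>\<^sub>F k in sequentially. (\<integral>\<^sup>+x. ennreal (u k x) \<partial>M) \<le> ennreal B"
      using u(3) by eventually_elim (use u(1,2) in \<open>auto simp: nn_integral_eq_integral ennreal_leI\<close>)
  qed simp
  finally have *: "(\<integral>\<^sup>+x. ennreal (v x) \<partial>M) \<le> ennreal B" .
  then show iv: "integrable M v"
    by (intro integrableI_nonneg) (use v in \<open>auto simp: order_le_less_trans\<close>)
  then show "integral\<^sup>L M v \<le> B"
    using * v(2) B by (simp add: nn_integral_eq_integral ennreal_le_iff)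
qed

text \<open>A sparse subsequence of partial sums has absolutely summable increments a.e. and hence a
  pointwise limit; Fatou then returns convergence in norm. Tails below \<open>(1/4)^k\<close> are
  chosen because the L1 norm costs a square root and still has to decay like
  \<open>(1/2)^k\<close>.\<close>

theorem Riesz_Fischer:
  assumes c: "summable (\<lambda>n. (norm (c n))\<^sup>2)"
  shows "\<exists>p. L2 p \<and> (\<forall>n. fcoeff p n = (if n < 0 then 0 else c (nat n))) \<and>
    (\<lambda>N. nsq (\<lambda>t. p t - tpoly c N t)) \<longlonglongrightarrow> 0"
proof -
  have tail: "\<exists>N. \<forall>m\<ge>N. \<forall>n\<ge>m. (\<Sum>i=m..<n. (norm (c i))\<^sup>2) \<le> e" if e: "e > 0" for e
  proof -
    obtain N where N: "\<forall>m\<ge>N. \<forall>n. norm (\<Sum>i=m..<n. (norm (c i))\<^sup>2) < e"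
      using c e unfolding summable_Cauchy by blast
    have "(\<Sum>i=m..<n. (norm (c i))\<^sup>2) \<le> e" if "m \<ge> N" for m n
      using N[rule_format, OF that, of n] by (simp add: abs_less_iff)
    then show ?thesis by blast
  qed
  have "\<exists>N. \<forall>m\<ge>N. \<forall>n\<ge>m. (\<Sum>i=m..<n. (norm (c i))\<^sup>2) \<le> (1/4)^k" for k :: nat
    by (rule tail) simp
  then obtain N0 where N0: "\<And>k m n. m \<ge> N0 k \<Longrightarrow> n \<ge> m \<Longrightarrow> (\<Sum>i=m..<n. (norm (c i))\<^sup>2) \<le> (1/4)^k"
    by metis
  \<comment> \<open>The sum makes \<open>M\<close> monotone and at least \<open>N0 k\<close>; the
    summand \<open>k\<close> makes it tend to infinity.\<close>
  define M where "M k = k + (\<Sum>j\<le>k. N0 j)" for k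
  have Mk: "M k \<ge> N0 k" "M k \<ge> k" for k
    using member_le_sum[of k "{..k}" N0] by (auto simp: M_def)
  have Mmono: "M k \<le> M (Suc k)" for k by (simp add: M_def)
  define u where "u k t = tpoly c (M (Suc k)) t - tpoly c (M k) t" for k t
  have uL2: "L2 (u k)" for k unfolding u_def by (intro L2_diff tpoly_L2)
  have ui: "integrable TT (u k)" for k by (rule L2_integrable[OF uL2])
  have un: "integral\<^sup>L TT (\<lambda>t. norm (u k t)) \<le> 2 * pi * (1/2)^k" for k
  proof -
    have "nsq (u k) \<le> 2 * pi * (1/4)^k"
      unfolding u_def nsq_tpoly_diff[OF Mmono] using N0[OF Mk(1) Mmono, of k] by simp
    then have "sqrt (2 * pi * nsq (u k)) \<le> sqrt (2 * pi * (2 * pi * (1/4)^k))"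
      by simp
    also have "\<dots> = sqrt ((2 * pi * (1/2)^k)\<^sup>2)"
      by (simp add: power2_eq_square flip: power_mult_distrib)
    also have "\<dots> = 2 * pi * (1/2)^k" by simp
    finally show ?thesis using integral_norm_le_sqrt_nsq[OF uL2, of k] by linarith
  qed
  have us: "summable (\<lambda>k. integral\<^sup>L TT (\<lambda>t. norm (u k t)))"
    by (rule summable_comparison_test'[of "\<lambda>k. 2 * pi * (1/2)^k" 0])
       (use un in \<open>auto intro!: summable_mult summable_geometric\<close>)
  have AEs: "AE t in TT. summable (\<lambda>k. norm (u k t))"
  proof -
    have [measurable]: "u k \<in> borel_measurable TT" for k using ui by auto
    have "(\<integral>\<^sup>+t. (\<Sum>k. ennreal (norm (u k t))) \<partial>TT) = (\<Sum>k. \<integral>\<^sup>+t. ennreal (norm (u k t)) \<partial>TT)"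
      by (rule nn_integral_suminf) auto
    also have "\<dots> = (\<Sum>k. ennreal (integral\<^sup>L TT (\<lambda>t. norm (u k t))))"
      using ui by (simp add: nn_integral_eq_integral)
    also have "\<dots> \<noteq> \<infinity>"
      using us by (simp add: ennreal_suminf_neq_top)
    finally have "AE t in TT. (\<Sum>k. ennreal (norm (u k t))) \<noteq> \<infinity>"
      by (intro nn_integral_PInf_AE) auto
    then show ?thesis by eventually_elim (auto intro: summable_suminf_not_top)
  qed
  define p where "p t = lim (\<lambda>k. tpoly c (M k) t)" for t
  have pm [measurable]: "p \<in> borel_measurable TT"
    unfolding p_def by (rule borel_measurable_lim_metric) auto
  have AEp: "AE t in TT. (\<lambda>k. tpoly c (M k) t) \<longlonglongrightarrow> p t"
    using AEs
  proof eventually_elim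
    case (elim t)
    then have "summable (\<lambda>k. u k t)" by (rule summable_norm_cancel)
    then have "convergent (\<lambda>n. \<Sum>k<n. u k t)" by (simp add: summable_iff_convergent)
    moreover have "(\<Sum>k<n. u k t) = tpoly c (M n) t - tpoly c (M 0) t" for n
      unfolding u_def by (rule sum_lessThan_telescope)
    ultimately have "convergent (\<lambda>n. tpoly c (M n) t - tpoly c (M 0) t)" by simp
    from convergent_add[OF this convergent_const[of "tpoly c (M 0) t"]]
    show ?case unfolding p_def by (simp add: convergent_LIMSEQ_iff)
  qed
  \<comment> \<open>Fatou along \<open>M k\<close> with \<open>m\<close> fixed. Integrability is
    part of the claim because \<open>p\<close> is so far only known to be measurable.\<close>
  have bnd: "\<exists>N. \<forall>m\<ge>N. integrable TT (\<lambda>t. (norm (p t - tpoly c m t))\<^sup>2) \<and> nsq (\<lambda>t. p t - tpoly c m t) \<le> 2 * pi * e"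
    if e: "e > 0" for e
  proof -
    obtain N where N: "\<And>m n. m \<ge> N \<Longrightarrow> n \<ge> m \<Longrightarrow> (\<Sum>i=m..<n. (norm (c i))\<^sup>2) \<le> e"
      using tail[OF e] by blast
    have "integrable TT (\<lambda>t. (norm (p t - tpoly c m t))\<^sup>2) \<and> nsq (\<lambda>t. p t - tpoly c m t) \<le> 2 * pi * e"
      if m: "m \<ge> N" for m
    proof -
      let ?u = "\<lambda>k t. (norm (tpoly c (M k) t - tpoly c m t))\<^sup>2"
      have "\<forall>\<^sub>F k in sequentially. integral\<^sup>L TT (?u k) \<le> 2 * pi * e"
        using eventually_ge_at_top[of m]
      proof eventually_elim
        case (elim k)
        then have "m \<le> M k" using Mk(2)[of k] by linarith
        then show ?case using N[OF m, of "M k"] by (simp add: nsq_tpoly_diff)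
      qed
      moreover have "AE t in TT. (\<lambda>k. ?u k t) \<longlonglongrightarrow> (norm (p t - tpoly c m t))\<^sup>2"
        using AEp by eventually_elim (auto intro!: tendsto_intros)
      moreover have "integrable TT (?u k)" for k
        using L2_diff[OF tpoly_L2 tpoly_L2] by (auto simp: L2_def)
      ultimately show ?thesis
        using Fatou_bound[of TT ?u "2 * pi * e" "\<lambda>t. (norm (p t - tpoly c m t))\<^sup>2"] by auto
    qed
    then show ?thesis by blast
  qed
  have dL2: "\<forall>\<^sub>F m in sequentially. L2 (\<lambda>t. p t - tpoly c m t)"
    using bnd[of 1] by (auto simp: L2_def eventually_sequentially)
  have pL2: "L2 p"
  proof -
    obtain m where "L2 (\<lambda>t. p t - tpoly c m t)" using dL2 by (auto simp: eventually_sequentially)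
    from L2_add[OF this tpoly_L2[of c m]] show ?thesis by simp
  qed
  have lim: "(\<lambda>N. nsq (\<lambda>t. p t - tpoly c N t)) \<longlonglongrightarrow> 0"
  proof (rule LIMSEQ_I)
    fix e :: real assume e: "e > 0"
    then obtain N where "\<forall>m\<ge>N. nsq (\<lambda>t. p t - tpoly c m t) \<le> 2 * pi * (e / (4 * pi))"
      using bnd[of "e / (4 * pi)"] by auto
    then have N: "\<forall>m\<ge>N. nsq (\<lambda>t. p t - tpoly c m t) \<le> e / 2"
      by (simp add: field_simps)
    have "norm (nsq (\<lambda>t. p t - tpoly c m t) - 0) < e" if "m \<ge> N" for m
    proof -
      have "nsq (\<lambda>t. p t - tpoly c m t) \<ge> 0" by simp
      moreover have "nsq (\<lambda>t. p t - tpoly c m t) \<le> e / 2" using N that by blast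
      ultimately show ?thesis using e by simp
    qed
    then show "\<exists>N. \<forall>m\<ge>N. norm (nsq (\<lambda>t. p t - tpoly c m t) - 0) < e" by blast
  qed
  have "fcoeff p n = (if n < 0 then 0 else c (nat n))" for n
  proof -
    have "(\<lambda>N. fcoeff p n - fcoeff (tpoly c N) n) \<longlonglongrightarrow> 0"
    proof (rule Lim_null_comparison)
      show "\<forall>\<^sub>F N in sequentially. norm (fcoeff p n - fcoeff (tpoly c N) n) \<le>
          sqrt (2 * pi * nsq (\<lambda>t. p t - tpoly c N t)) / (2*pi)"
      proof (rule always_eventually, rule allI)
        fix N
        have d: "L2 (\<lambda>t. p t - tpoly c N t)" by (intro L2_diff pL2 tpoly_L2)
        show "norm (fcoeff p n - fcoeff (tpoly c N) n) \<le> sqrt (2 * pi * nsq (\<lambda>t. p t - tpoly c N t)) / (2*pi)"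
          using norm_fcoeff_le[OF L2_integrable[OF d], of n]
            fcoeff_diff[OF L2_integrable[OF pL2] L2_integrable[OF tpoly_L2], of c N n]
            divide_right_mono[OF integral_norm_le_sqrt_nsq[OF d], of "2*pi"] by simp
      qed
      have "(\<lambda>N. sqrt (2 * pi * nsq (\<lambda>t. p t - tpoly c N t)) / (2*pi)) \<longlonglongrightarrow> sqrt (2 * pi * 0) / (2*pi)"
        by (intro tendsto_intros lim) auto
      then show "(\<lambda>N. sqrt (2 * pi * nsq (\<lambda>t. p t - tpoly c N t)) / (2*pi)) \<longlonglongrightarrow> 0" by simp
    qed
    moreover have "(\<lambda>N. fcoeff p n - fcoeff (tpoly c N) n) \<longlonglongrightarrow> fcoeff p n - (if n < 0 then 0 else c (nat n))"
    proof (rule tendsto_eventually)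
      show "\<forall>\<^sub>F N in sequentially. fcoeff p n - fcoeff (tpoly c N) n = fcoeff p n - (if n < 0 then 0 else c (nat n))"
        using eventually_gt_at_top[of "nat n"]
        by eventually_elim (auto simp: fcoeff_tpoly)
    qed
    ultimately have "0 = fcoeff p n - (if n < 0 then 0 else c (nat n))"
      by (rule LIMSEQ_unique)
    then show ?thesis by simp
  qed
  with pL2 lim show ?thesis by (intro exI[of _ p] conjI allI)
qed

text \<open>Riesz-Fischer builds a function with the same coefficients whose partial sums do
  converge. Since \<open>f\<close> has no negative frequencies either, uniqueness identifies the two
  a.e.\<close>

lemma H2_tpoly_LIMSEQ:
  assumes f: "H2 f"
  shows "(\<lambda>N. nsq (\<lambda>t. f t - tpoly (\<lambda>n. fcoeff f (int n)) N t)) \<longlonglongrightarrow> 0"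
proof -
  have fL2: "L2 f" by (rule H2_L2[OF f])
  define c where "c n = fcoeff f (int n)" for n
  have "\<exists>p. L2 p \<and> (\<forall>n. fcoeff p n = (if n < 0 then 0 else c (nat n))) \<and>
    (\<lambda>N. nsq (\<lambda>t. p t - tpoly c N t)) \<longlonglongrightarrow> 0"
    by (rule Riesz_Fischer) (use Bessel_summable[OF fL2] in \<open>simp add: c_def\<close>)
  then obtain p where p': "L2 p \<and> (\<forall>n. fcoeff p n = (if n < 0 then 0 else c (nat n))) \<and>
    (\<lambda>N. nsq (\<lambda>t. p t - tpoly c N t)) \<longlonglongrightarrow> 0" by (rule exE)
  have p: "L2 p" "\<And>n. fcoeff p n = (if n < 0 then 0 else c (nat n))"
    "(\<lambda>N. nsq (\<lambda>t. p t - tpoly c N t)) \<longlonglongrightarrow> 0"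
    using p' by simp_all
  have "AE t in TT. f t - p t = 0"
  proof (rule AE_zero_if_fcoeff_zero)
    show "fcoeff (\<lambda>t. f t - p t) n = 0" for n
    proof (cases "n < 0")
      case True
      then have "fcoeff f n = 0" using f unfolding H2_def by blast
      then show ?thesis
        unfolding fcoeff_diff[OF L2_integrable[OF fL2] L2_integrable[OF p(1)]] p(2) using True by simp
    next
      case False
      then show ?thesis
        unfolding fcoeff_diff[OF L2_integrable[OF fL2] L2_integrable[OF p(1)]] p(2) c_def by simp
    qed
    show "integrable TT (\<lambda>t. f t - p t)" by (rule L2_integrable[OF L2_diff[OF fL2 p(1)]])
  qed
  then have ae: "AE t in TT. f t = p t" by eventually_elim simp
  have [measurable]: "f \<in> borel_measurable TT" "p \<in> borel_measurable TT"
    using fL2 p(1) by (auto simp: L2_def)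
  have "nsq (\<lambda>t. f t - tpoly c N t) = nsq (\<lambda>t. p t - tpoly c N t)" for N
  proof (rule integral_cong_AE)
    show "AE t in TT. (norm (f t - tpoly c N t))\<^sup>2 = (norm (p t - tpoly c N t))\<^sup>2"
      using ae by eventually_elim simp
  qed measurable
  then have eq: "(\<lambda>N. nsq (\<lambda>t. f t - tpoly c N t)) = (\<lambda>N. nsq (\<lambda>t. p t - tpoly c N t))"
    by (rule ext)
  have c: "c = (\<lambda>n. fcoeff f (int n))" by (rule ext) (rule c_def)
  show ?thesis
    unfolding c[symmetric] by (rule ssubst[OF eq, of "\<lambda>s. s \<longlonglongrightarrow> 0"]) (rule p(3))
qed

lemma H2_Parseval:
  assumes f: "H2 f"
  shows "(\<lambda>n. (norm (fcoeff f (int n)))\<^sup>2) sums (nsq f / (2*pi))"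
proof -
  have lim: "(\<lambda>N. (nsq f - nsq (\<lambda>t. f t - tpoly (\<lambda>n. fcoeff f (int n)) N t)) / (2*pi)) \<longlonglongrightarrow> (nsq f - 0) / (2*pi)"
    by (rule tendsto_divide[OF tendsto_diff[OF tendsto_const H2_tpoly_LIMSEQ[OF f]] tendsto_const]) simp
  have eq: "(nsq f - nsq (\<lambda>t. f t - tpoly (\<lambda>n. fcoeff f (int n)) N t)) / (2*pi) =
      (\<Sum>n<N. (norm (fcoeff f (int n)))\<^sup>2)" for N
    by (subst nsq_diff_tpoly[OF H2_L2[OF f]]) simp
  show ?thesis unfolding sums_def using lim unfolding eq diff_zero .
qed

text \<open>The product is only integrable. By Cauchy-Schwarz its coefficients are limits of those
  of partial sums of \<open>a\<close> times \<open>b\<close>, and these are stationary once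
  \<open>N\<close> exceeds the index.\<close>

lemma fcoeff_H2_mult:
  assumes a: "H2 a" and b: "H2 b"
  shows "fcoeff (\<lambda>t. a t * b t) k =
    (if k < 0 then 0 else \<Sum>j\<le>nat k. fcoeff a (int j) * fcoeff b (int (nat k - j)))"
proof -
  let ?c = "\<lambda>n. fcoeff a (int n)"
  note L = H2_L2[OF a] H2_L2[OF b]
  have "(\<lambda>N. fcoeff (\<lambda>t. a t * b t) k - fcoeff (\<lambda>t. tpoly ?c N t * b t) k) \<longlonglongrightarrow> 0"
  proof (rule Lim_null_comparison)
    show "\<forall>\<^sub>F N in sequentially. norm (fcoeff (\<lambda>t. a t * b t) k - fcoeff (\<lambda>t. tpoly ?c N t * b t) k)
       \<le> sqrt (nsq (\<lambda>t. a t - tpoly ?c N t) * nsq b) / (2*pi)"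
    proof (rule always_eventually, rule allI)
      fix N
      have d: "L2 (\<lambda>t. a t - tpoly ?c N t)" by (intro L2_diff L tpoly_L2)
      have "fcoeff (\<lambda>t. a t * b t) k - fcoeff (\<lambda>t. tpoly ?c N t * b t) k =
        fcoeff (\<lambda>t. (a t - tpoly ?c N t) * b t) k"
        by (subst fcoeff_diff[symmetric])
           (auto intro!: L2_mult_integrable L tpoly_L2 simp: left_diff_distrib)
      then show "norm (fcoeff (\<lambda>t. a t * b t) k - fcoeff (\<lambda>t. tpoly ?c N t * b t) k)
       \<le> sqrt (nsq (\<lambda>t. a t - tpoly ?c N t) * nsq b) / (2*pi)"
        using norm_fcoeff_le[OF L2_mult_integrable[OF d L(2)], of k]
          divide_right_mono[OF integral_norm_mult_le[OF d L(2)], of "2*pi"] by simp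
    qed
    have "(\<lambda>N. sqrt (nsq (\<lambda>t. a t - tpoly ?c N t) * nsq b) / (2*pi)) \<longlonglongrightarrow> sqrt (0 * nsq b) / (2*pi)"
      by (rule tendsto_divide[OF tendsto_real_sqrt[OF tendsto_mult[OF H2_tpoly_LIMSEQ[OF a] tendsto_const]] tendsto_const]) simp
    then show "(\<lambda>N. sqrt (nsq (\<lambda>t. a t - tpoly ?c N t) * nsq b) / (2*pi)) \<longlonglongrightarrow> 0" by simp
  qed
  moreover have "(\<lambda>N. fcoeff (\<lambda>t. a t * b t) k - fcoeff (\<lambda>t. tpoly ?c N t * b t) k) \<longlonglongrightarrow>
     fcoeff (\<lambda>t. a t * b t) k - (if k < 0 then 0 else \<Sum>j\<le>nat k. fcoeff a (int j) * fcoeff b (int (nat k - j)))"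
  proof (rule tendsto_eventually)
    have b0: "fcoeff b n = 0" if "n < 0" for n using b that by (simp add: H2_def)
    show "\<forall>\<^sub>F N in sequentially. fcoeff (\<lambda>t. a t * b t) k - fcoeff (\<lambda>t. tpoly ?c N t * b t) k =
      fcoeff (\<lambda>t. a t * b t) k - (if k < 0 then 0 else \<Sum>j\<le>nat k. fcoeff a (int j) * fcoeff b (int (nat k - j)))"
      using eventually_gt_at_top[of "nat k"]
    proof eventually_elim
      case (elim N)
      have "(\<Sum>n<N. ?c n * fcoeff b (k - int n)) =
        (if k < 0 then 0 else \<Sum>j\<le>nat k. fcoeff a (int j) * fcoeff b (int (nat k - j)))"
      proof (cases "k < 0")
        case True
        then have "fcoeff b (k - int n) = 0" for n by (intro b0) simp
        with True show ?thesis by simp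
      next
        case False
        have "(\<Sum>n<N. ?c n * fcoeff b (k - int n)) = (\<Sum>n\<le>nat k. ?c n * fcoeff b (int (nat k - n)))"
        proof (rule sum.mono_neutral_cong_right)
          show "\<forall>i\<in>{..<N} - {..nat k}. ?c i * fcoeff b (k - int i) = 0"
          proof
            fix i assume "i \<in> {..<N} - {..nat k}"
            then have "k - int i < 0" using False by auto
            then show "?c i * fcoeff b (k - int i) = 0" by (simp only: b0 mult_zero_right)
          qed
          show "?c x * fcoeff b (k - int x) = ?c x * fcoeff b (int (nat k - x))" if "x \<in> {..nat k}" for x
          proof -
            have "k - int x = int (nat k - x)" using that False by auto
            then show ?thesis by (simp only:)
          qed
        qed (use elim in auto)
        then show ?thesis using False by (simp only: if_False)
      qed
      then show ?case by (simp only: fcoeff_tpoly_mult[OF L2_integrable[OF L(2)]])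
    qed
  qed
  ultimately have "0 = fcoeff (\<lambda>t. a t * b t) k -
      (if k < 0 then 0 else \<Sum>j\<le>nat k. fcoeff a (int j) * fcoeff b (int (nat k - j)))"
    by (rule LIMSEQ_unique)
  then show ?thesis by (subst eq_iff_diff_eq_0) (rule sym)
qed

subsection \<open>The analytic extension to the disc\<close>

text \<open>The power series on the left-hand side of the formula in \<open>outer\<close>. Being
  defined by coefficients, it makes sense for integrable functions, in particular for products of
  two \<open>H2\<close> functions.\<close>

definition hser :: "(real \<Rightarrow> complex) \<Rightarrow> complex \<Rightarrow> complex" where
  "hser f z = (\<Sum>n. fcoeff f (int n) * z ^ n)"

lemma summable_norm_hser:
  assumes f: "integrable TT f" and z: "norm z < 1"
  shows "summable (\<lambda>n. norm (fcoeff f (int n) * z ^ n))"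
proof (rule summable_comparison_test'[of "\<lambda>n. (integral\<^sup>L TT (\<lambda>t. norm (f t)) / (2*pi)) * norm z ^ n" 0])
  show "summable (\<lambda>n. (integral\<^sup>L TT (\<lambda>t. norm (f t)) / (2*pi)) * norm z ^ n)"
    by (intro summable_mult summable_geometric) (use z in auto)
  show "norm (norm (fcoeff f (int n) * z ^ n)) \<le> (integral\<^sup>L TT (\<lambda>t. norm (f t)) / (2*pi)) * norm z ^ n" for n
    unfolding norm_mult norm_power real_norm_def abs_mult abs_norm_cancel power_abs
    using norm_fcoeff_le[OF f, of "int n"] by (intro mult_right_mono) auto
qed

lemma hser_sums:
  assumes "integrable TT f" "norm z < 1"
  shows "(\<lambda>n. fcoeff f (int n) * z ^ n) sums hser f z"
  unfolding hser_def by (rule summable_sums, rule summable_norm_cancel, rule summable_norm_hser[OF assms])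

lemma hser_holomorphic:
  assumes "integrable TT f"
  shows "hser f holomorphic_on ball 0 1"
  by (rule power_series_holomorphic) (use hser_sums[OF assms] in auto)

lemma hser_cong_AE:
  assumes "f \<in> borel_measurable TT" "g \<in> borel_measurable TT" "AE t in TT. f t = g t"
  shows "hser f z = hser g z"
  unfolding hser_def using fcoeff_cong_AE[OF assms] by simp

lemma hser_mult:
  assumes a: "H2 a" and b: "H2 b" and z: "norm z < 1"
  shows "hser (\<lambda>t. a t * b t) z = hser a z * hser b z"
proof -
  have i: "integrable TT a" "integrable TT b" using a b by (auto intro: L2_integrable H2_L2)
  have "hser a z * hser b z = (\<Sum>k. \<Sum>j\<le>k. (fcoeff a (int j) * z ^ j) * (fcoeff b (int (k - j)) * z ^ (k - j)))"
    unfolding hser_def by (rule Cauchy_product) (intro summable_norm_hser i z)+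
  also have "\<dots> = (\<Sum>k. fcoeff (\<lambda>t. a t * b t) (int k) * z ^ k)"
  proof (rule suminf_cong)
    fix k
    have "(\<Sum>j\<le>k. (fcoeff a (int j) * z ^ j) * (fcoeff b (int (k - j)) * z ^ (k - j))) =
      (\<Sum>j\<le>k. (fcoeff a (int j) * fcoeff b (int (k - j))) * z ^ k)"
      by (intro sum.cong refl) (simp add: mult_ac flip: power_add)
    then show "(\<Sum>j\<le>k. (fcoeff a (int j) * z ^ j) * (fcoeff b (int (k - j)) * z ^ (k - j))) =
      fcoeff (\<lambda>t. a t * b t) (int k) * z ^ k"
      unfolding fcoeff_H2_mult[OF a b] by (simp flip: sum_distrib_right)
  qed
  finally show ?thesis by (simp add: hser_def)
qed

lemma power_series_coeff_unique:
  fixes a b :: "nat \<Rightarrow> complex"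
  assumes a: "\<And>z. norm z < 1 \<Longrightarrow> (\<lambda>n. a n * z ^ n) sums F z"
    and b: "\<And>z. norm z < 1 \<Longrightarrow> (\<lambda>n. b n * z ^ n) sums F z"
  shows "a n = b n"
proof -
  have half: "norm (1 / 2 :: complex) < 1" by simp
  have r: "conv_radius f > 0" if "\<And>z. norm z < 1 \<Longrightarrow> (\<lambda>n. f n * z ^ n) sums F z" for f :: "nat \<Rightarrow> complex"
    using conv_radius_geI[OF sums_summable[OF that[OF half]]] by (auto intro: less_le_trans[of 0 "ereal (1/2)"])
  have "Abs_fps a = Abs_fps b"
  proof (rule eval_fps_eqD)
    show "fps_conv_radius (Abs_fps a) > 0" "fps_conv_radius (Abs_fps b) > 0"
      using r[OF a] r[OF b] by (auto simp: fps_conv_radius_def)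
    have "\<forall>\<^sub>F z :: complex in nhds 0. z \<in> ball 0 1"
      by (rule eventually_nhds_in_open) auto
    then show "\<forall>\<^sub>F z in nhds 0. eval_fps (Abs_fps a) z = eval_fps (Abs_fps b) z"
    proof eventually_elim
      case (elim z)
      then have z: "norm z < 1" by simp
      show ?case
        unfolding eval_fps_def using sums_unique[OF a[OF z]] sums_unique[OF b[OF z]] by simp
    qed
  qed
  then show ?thesis by (simp add: fps_eq_iff)
qed

text \<open>The way back from the disc to the circle. It is stated for integrable functions because
  it is applied to products.\<close>

lemma AE_eq_if_hser_eq:
  assumes f: "integrable TT f" "\<And>n. n < 0 \<Longrightarrow> fcoeff f n = 0"
    and g: "integrable TT g" "\<And>n. n < 0 \<Longrightarrow> fcoeff g n = 0"
    and eq: "\<And>z. norm z < 1 \<Longrightarrow> hser f z = hser g z"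
  shows "AE t in TT. f t = g t"
proof -
  have c: "fcoeff f (int n) = fcoeff g (int n)" for n
    by (rule power_series_coeff_unique[of _ "hser g"]) (use hser_sums[OF f(1)] hser_sums[OF g(1)] eq in auto)
  have "AE t in TT. f t - g t = 0"
  proof (rule AE_zero_if_fcoeff_zero)
    show "integrable TT (\<lambda>t. f t - g t)" using f(1) g(1) by auto
    show "fcoeff (\<lambda>t. f t - g t) n = 0" for n
      unfolding fcoeff_diff[OF f(1) g(1)]
      using f(2)[of n] g(2)[of n] c[of "nat n"] by (cases "n < 0") auto
  qed
  then show ?thesis by eventually_elim simp
qed

lemma H2_nonzero_hser:
  assumes f: "H2 f" and nz: "\<not> (AE t in TT. f t = 0)"
  obtains z where "norm z < 1" "hser f z \<noteq> 0"
proof -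
  have "\<exists>z. norm z < 1 \<and> hser f z \<noteq> 0"
  proof (rule ccontr)
    assume *: "\<not> (\<exists>z. norm z < 1 \<and> hser f z \<noteq> 0)"
    have z: "fcoeff (\<lambda>_. 0) n = 0" for n by (simp add: fcoeff_def)
    have "AE t in TT. f t = 0"
      by (rule AE_eq_if_hser_eq)
         (use f * in \<open>auto simp: z hser_def[of "\<lambda>_. 0"] H2_def intro: L2_integrable\<close>)
    with nz show False by simp
  qed
  then show ?thesis using that by blast
qed

subsection \<open>Jensen's inequality and logarithmic integrability\<close>

definition ppoly :: "(nat \<Rightarrow> complex) \<Rightarrow> nat \<Rightarrow> complex \<Rightarrow> complex" where
  "ppoly c N z = (\<Sum>n<N. c n * z ^ n)"

lemma tpoly_eq_ppoly: "tpoly c N t = ppoly c N (cis t)"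
  unfolding tpoly_def ppoly_def by (simp add: Complex.DeMoivre)

text \<open>The shift by \<open>e\<close> makes ln Lipschitz with constant \<open>1 / e\<close>, so
  L1 convergence of functions passes to their regularised log moduli.\<close>

lemma ln_add_diff_le:
  fixes x y e :: real
  assumes "0 \<le> x" "0 \<le> y" "e > 0"
  shows "\<bar>ln (x + e) - ln (y + e)\<bar> \<le> \<bar>x - y\<bar> / e"
proof -
  have *: "ln (x + e) - ln (y + e) \<le> \<bar>x - y\<bar> / e" if "0 \<le> x" "0 \<le> y" for x y :: real
  proof -
    have "ln (x + e) - ln (y + e) \<le> ((x + e) - (y + e)) / (y + e)"
      using that assms(3) by (intro ln_diff_le) auto
    also have "\<dots> \<le> \<bar>x - y\<bar> / e"
      using that assms(3) by (intro frac_le) auto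
    finally show ?thesis .
  qed
  from *[OF assms(1,2)] *[OF assms(2,1)] show ?thesis by (simp add: abs_minus_commute abs_le_iff)
qed

lemma pint_continuous:
  assumes f: "integrable TT f" and z: "norm z < 1"
  shows "(\<lambda>n. pint f (of_real (rad n) * z)) \<longlonglongrightarrow> pint f z"
proof -
  have "continuous_on (ball 0 1) (herg f)"
    by (rule holomorphic_on_imp_continuous_on[OF herg_holomorphic[OF f]])
  then have c: "isCont (herg f) z"
    using z by (simp add: continuous_on_eq_continuous_at)
  have "(\<lambda>n. complex_of_real (rad n) * z) \<longlonglongrightarrow> of_real 1 * z"
    by (intro tendsto_intros rad_LIMSEQ)
  then have "(\<lambda>n. Re (herg f (of_real (rad n) * z))) \<longlonglongrightarrow> Re (herg f z)"
    using isCont_tendsto_compose[OF c] by (intro tendsto_Re) simp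
  moreover have "norm (complex_of_real (rad n) * z) < 1" for n
    using rad[of n] z mult_strict_mono'[of "rad n" 1 "norm z" 1] by (simp add: norm_mult)
  ultimately show ?thesis using Re_herg[OF f] z by simp
qed

text \<open>Maximum principle for the polynomial times \<open>exp (- herg u (r w))\<close>: since \<open>u\<close> is continuous on the
  circle, the modulus is close to at most \<open>1\<close> there once \<open>r\<close> is close to \<open>1\<close>.\<close>

lemma polynomial_Jensen:
  assumes e: "e > 0" and z: "norm z < 1"
  shows "norm (ppoly c N z) \<le> exp (pint (\<lambda>t. ln (norm (tpoly c N t) + e)) z)"
proof -
  define U where "U w = ln (norm (ppoly c N w) + e)" for w
  define u where "u t = U (cis t)" for t
  have u_eq: "(\<lambda>t. ln (norm (tpoly c N t) + e)) = u"
    by (auto simp: u_def U_def tpoly_eq_ppoly)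
  have pos: "norm (ppoly c N w) + e > 0" for w using e by (simp add: add_nonneg_pos)
  have Uc: "continuous_on (sphere 0 1) U"
    unfolding U_def ppoly_def by (intro continuous_intros) (use pos[unfolded ppoly_def] in \<open>metis less_irrefl\<close>)
  obtain M where M: "\<And>w. w \<in> sphere 0 1 \<Longrightarrow> \<bar>U w\<bar> \<le> M"
    using compact_imp_bounded[OF compact_continuous_image[OF Uc compact_sphere]]
    unfolding bounded_iff by (metis imageI real_norm_def)
  have uM: "\<bar>u t\<bar> \<le> M" for t unfolding u_def by (rule M) simp
  have um: "u \<in> borel_measurable TT"
    unfolding u_eq[symmetric] by measurable
  have ui: "integrable TT u" by (rule integrable_TT_bounded[OF um, of M]) (use uM in auto)
  \<comment> \<open>One \<open>\<eta>\<close> pays for the oscillation of \<open>u\<close> on short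
    arcs, the other for the Poisson kernel outside them.\<close>
  have main: "norm (ppoly c N z) \<le> exp (2 * \<eta>) * exp (pint u z)" if eta: "\<eta> > 0" for \<eta>
  proof -
    have "uniformly_continuous_on (sphere 0 1) U"
      by (rule compact_uniformly_continuous[OF Uc compact_sphere])
    then obtain \<delta> where d: "\<delta> > 0"
      "\<And>w w'. w \<in> sphere 0 1 \<Longrightarrow> w' \<in> sphere 0 1 \<Longrightarrow> dist w' w < \<delta> \<Longrightarrow> dist (U w') (U w) < \<eta>"
      unfolding uniformly_continuous_on_def using eta by metis
    have "(\<lambda>n. 8 * M * (1 - (rad n)\<^sup>2) / \<delta>\<^sup>2) \<longlonglongrightarrow> 8 * M * (1 - 1\<^sup>2) / \<delta>\<^sup>2"
      by (intro tendsto_intros rad_LIMSEQ) (use d in auto)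
    then have ev1: "\<forall>\<^sub>F n in sequentially. 8 * M * (1 - (rad n)\<^sup>2) / \<delta>\<^sup>2 < \<eta>"
      by (rule order_tendstoD) (use eta in simp)
    have ev2: "\<forall>\<^sub>F n in sequentially. rad n > 1 - \<delta> / 2"
      by (rule order_tendstoD(1)[OF rad_LIMSEQ]) (use d in simp)
    have "\<forall>\<^sub>F n in sequentially. norm (ppoly c N z) \<le> exp (2 * \<eta>) * exp (pint u (of_real (rad n) * z))"
      using ev1 ev2
    proof eventually_elim
      case (elim n)
      let ?r = "rad n"
      have near: "\<bar>pint u (of_real ?r * cis s) - u s\<bar> \<le> 2 * \<eta>" for s
      proof -
        have "\<bar>pint u (of_real ?r * cis s) - u s\<bar> \<le> \<eta> + 8 * M * (1 - ?r\<^sup>2) / \<delta>\<^sup>2"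
        proof (rule pint_near_boundary_value[OF um uM uM])
          show "\<bar>u t - u s\<bar> \<le> \<eta>" if "norm (cis t - cis s) < \<delta>" for t
            using d(2)[of "cis s" "cis t"] that by (auto simp: u_def dist_norm dist_real_def)
        qed (use d eta elim rad[of n] in auto)
        with elim show ?thesis by linarith
      qed
      have rz: "norm (complex_of_real ?r * w) < 1" if "norm w \<le> 1" for w
        using rad[of n] that mult_left_mono[OF that, of ?r] by (simp add: norm_mult)
      \<comment> \<open>\<open>herg u\<close> is controlled only in the open disc; dilation by
        \<open>?r < 1\<close> makes \<open>G\<close> continuous up to the circle, as the maximum
        principle requires.\<close>
      define G where "G w = ppoly c N w * exp (- herg u (of_real ?r * w))" for w
      have hc: "(\<lambda>w. herg u (of_real ?r * w)) holomorphic_on T" if "\<And>w. w \<in> T \<Longrightarrow> norm w \<le> 1" for T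
      proof -
        have sub: "(\<lambda>w. complex_of_real ?r * w) ` T \<subseteq> ball 0 1"
        proof (rule image_subsetI)
          fix w assume "w \<in> T"
          then show "complex_of_real ?r * w \<in> ball 0 1" using rz[OF that] by (simp only: mem_ball_0)
        qed
        have "(herg u \<circ> (\<lambda>w. complex_of_real ?r * w)) holomorphic_on T"
          by (rule holomorphic_on_compose_gen[OF _ herg_holomorphic[OF ui] sub]) (intro holomorphic_intros)
        then show ?thesis by (simp only: o_def)
      qed
      have "norm (G z) \<le> exp (2 * \<eta>)"
      proof (rule maximum_modulus_frontier[of G "ball 0 1"])
        show "G holomorphic_on interior (ball 0 1)"
          unfolding G_def ppoly_def by (intro holomorphic_intros hc) auto
        have "G holomorphic_on cball 0 1"
          unfolding G_def ppoly_def by (intro holomorphic_intros hc) auto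
        then show "continuous_on (closure (ball 0 1)) G"
          by (simp add: holomorphic_on_imp_continuous_on)
        show "norm (G w) \<le> exp (2 * \<eta>)" if "w \<in> frontier (ball 0 1)" for w
        proof -
          have "norm w = 1" using that by (simp add: frontier_ball)
          then obtain s where w: "w = cis s" by (metis cis_Arg norm_zero sgn_eq zero_neq_one div_by_1 of_real_1)
          have "norm (G w) = norm (ppoly c N w) * exp (- pint u (of_real ?r * w))"
            using Re_herg[OF ui rz[of w]] \<open>norm w = 1\<close> by (simp add: G_def norm_mult)
          also have "\<dots> \<le> exp (u s) * exp (2 * \<eta> - u s)"
          proof (rule mult_mono)
            have "norm (ppoly c N w) \<le> norm (ppoly c N w) + e" using e by simp
            also have "\<dots> = exp (u s)" using pos[of w] by (simp add: u_def U_def w)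
            finally show "norm (ppoly c N w) \<le> exp (u s)" .
            show "exp (- pint u (of_real ?r * w)) \<le> exp (2 * \<eta> - u s)"
              using near[of s] w by auto
          qed auto
          also have "\<dots> = exp (2 * \<eta>)" by (simp flip: exp_add)
          finally show ?thesis .
        qed
      qed (use z in auto)
      moreover have "norm (G z) = norm (ppoly c N z) / exp (pint u (of_real ?r * z))"
        using Re_herg[OF ui rz[of z]] z by (simp add: G_def norm_mult norm_inverse exp_minus divide_inverse)
      ultimately show ?case by (simp add: pos_divide_le_eq)
    qed
    moreover have "(\<lambda>n. exp (2 * \<eta>) * exp (pint u (of_real (rad n) * z))) \<longlonglongrightarrow> exp (2 * \<eta>) * exp (pint u z)"
      by (intro tendsto_intros pint_continuous ui z)
    ultimately show ?thesis
      by (intro tendsto_lowerbound[of "\<lambda>n. exp (2 * \<eta>) * exp (pint u (of_real (rad n) * z))"]) auto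
  qed
  have "(\<lambda>n. exp (2 * inverse (real (Suc n))) * exp (pint u z)) \<longlonglongrightarrow> exp (2 * 0) * exp (pint u z)"
    by (intro tendsto_intros LIMSEQ_inverse_real_of_nat)
  then have "norm (ppoly c N z) \<le> exp (2 * 0) * exp (pint u z)"
    by (rule tendsto_lowerbound) (use main in auto)
  then show ?thesis by (simp add: u_eq)
qed

lemma integrable_ln_add:
  assumes f: "integrable TT (f :: real \<Rightarrow> complex)" and e: "e > 0"
  shows "integrable TT (\<lambda>t. ln (norm (f t) + e))"
proof (rule Bochner_Integration.integrable_bound)
  show "integrable TT (\<lambda>t. norm (f t) / e + \<bar>ln e\<bar>)"
    using f integrable_TT_const by auto
  show "AE t in TT. norm (ln (norm (f t) + e)) \<le> norm (norm (f t) / e + \<bar>ln e\<bar>)"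
  proof (rule AE_I2)
    fix t
    have "\<bar>ln (norm (f t) + e) - ln (0 + e)\<bar> \<le> \<bar>norm (f t) - 0\<bar> / e"
      by (rule ln_add_diff_le) (use e in auto)
    then show "norm (ln (norm (f t) + e)) \<le> norm (norm (f t) / e + \<bar>ln e\<bar>)"
      using e by (auto simp: abs_le_iff)
  qed
qed (use f in measurable)

text \<open>Partial sums converge in norm on the circle and pointwise in the disc; with
  \<open>e\<close> fixed, the exponent is continuous under that convergence.\<close>

lemma H2_Jensen_eps:
  assumes a: "H2 a" and e: "e > 0" and z: "norm z < 1"
  shows "norm (hser a z) \<le> exp (pint (\<lambda>t. ln (norm (a t) + e)) z)"
proof -
  define c where "c n = fcoeff a (int n)" for n
  have c: "c = (\<lambda>n. fcoeff a (int n))" by (rule ext) (rule c_def)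
  have aL: "L2 a" by (rule H2_L2[OF a])
  have ai: "integrable TT a" by (rule L2_integrable[OF aL])
  let ?p = "\<lambda>f. pint (\<lambda>t. ln (norm (f t) + e)) z"
  have l1: "(\<lambda>N. norm (ppoly c N z)) \<longlonglongrightarrow> norm (hser a z)"
    using hser_sums[OF ai z] unfolding sums_def ppoly_def c by (rule tendsto_norm)
  have l2: "(\<lambda>N. ?p (tpoly c N) - ?p a) \<longlonglongrightarrow> 0"
  proof (rule Lim_null_comparison)
    \<comment> \<open>Kernel bound \<open>2 / (1 - norm z)\<close>, Lipschitz constant
      \<open>1 / e\<close>, and the normalisation of \<open>pint\<close>.\<close>
    let ?K = "2 / (1 - norm z) / e / (2 * pi)"
    show "\<forall>\<^sub>F N in sequentially. norm (?p (tpoly c N) - ?p a) \<le> ?K * sqrt (2 * pi * nsq (\<lambda>t. a t - tpoly c N t))"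
    proof (rule always_eventually, rule allI)
      fix N
      have d: "L2 (\<lambda>t. a t - tpoly c N t)" by (intro L2_diff aL tpoly_L2)
      have i: "integrable TT (\<lambda>t. ln (norm (tpoly c N t) + e))" "integrable TT (\<lambda>t. ln (norm (a t) + e))"
        by (intro integrable_ln_add e ai L2_integrable tpoly_L2)+
      have i': "integrable TT (\<lambda>t. ln (norm (tpoly c N t) + e) - ln (norm (a t) + e))" using i by auto
      have i'': "integrable TT (\<lambda>t. norm (a t - tpoly c N t))" using L2_integrable[OF d] by auto
      have "norm (?p (tpoly c N) - ?p a) = \<bar>pint (\<lambda>t. ln (norm (tpoly c N t) + e) - ln (norm (a t) + e)) z\<bar>"
        by (subst pint_diff[OF i z]) simp
      also have "\<dots> \<le> pint (\<lambda>t. \<bar>ln (norm (tpoly c N t) + e) - ln (norm (a t) + e)\<bar>) z"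
        by (rule abs_pint_le[OF i' z])
      also have "\<dots> \<le> integral\<^sup>L TT (\<lambda>t. 2 / (1 - norm z) / e * norm (a t - tpoly c N t)) / (2 * pi)"
        unfolding pint_def
      proof (intro divide_right_mono integral_mono integrable_pois_mult[OF integrable_abs[OF i'] z])
        fix t
        have "\<bar>ln (norm (tpoly c N t) + e) - ln (norm (a t) + e)\<bar> \<le> \<bar>norm (tpoly c N t) - norm (a t)\<bar> / e"
          by (rule ln_add_diff_le) (use e in auto)
        also have "\<dots> \<le> norm (a t - tpoly c N t) / e"
          using e norm_triangle_ineq3[of "tpoly c N t" "a t"] by (simp add: divide_right_mono norm_minus_commute)
        finally have "pois z t * \<bar>ln (norm (tpoly c N t) + e) - ln (norm (a t) + e)\<bar> \<le>
            2 / (1 - norm z) * (norm (a t - tpoly c N t) / e)"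
          using pois_le[OF z, of t] pois_pos[OF z, of t] z by (intro mult_mono) auto
        then show "pois z t * \<bar>ln (norm (tpoly c N t) + e) - ln (norm (a t) + e)\<bar> \<le>
            2 / (1 - norm z) / e * norm (a t - tpoly c N t)" by simp
      qed (use i'' in auto)
      also have "\<dots> = ?K * integral\<^sup>L TT (\<lambda>t. norm (a t - tpoly c N t))"
        by simp
      also have "\<dots> \<le> ?K * sqrt (2 * pi * nsq (\<lambda>t. a t - tpoly c N t))"
        by (intro mult_left_mono integral_norm_le_sqrt_nsq[OF d]) (use e z in auto)
      finally show "norm (?p (tpoly c N) - ?p a) \<le> ?K * sqrt (2 * pi * nsq (\<lambda>t. a t - tpoly c N t))" .
    qed
    have n0: "(\<lambda>N. nsq (\<lambda>t. a t - tpoly c N t)) \<longlonglongrightarrow> 0"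
      unfolding c by (rule H2_tpoly_LIMSEQ[OF a])
    have "(\<lambda>N. ?K * sqrt (2 * pi * nsq (\<lambda>t. a t - tpoly c N t))) \<longlonglongrightarrow> ?K * sqrt (2 * pi * 0)"
      by (rule tendsto_mult[OF tendsto_const tendsto_real_sqrt[OF tendsto_mult[OF tendsto_const n0]]])
    then show "(\<lambda>N. ?K * sqrt (2 * pi * nsq (\<lambda>t. a t - tpoly c N t))) \<longlonglongrightarrow> 0" by simp
  qed
  have l3: "(\<lambda>N. ?p (tpoly c N)) \<longlonglongrightarrow> ?p a"
    by (rule LIM_zero_cancel[OF l2])
  show ?thesis
    by (rule LIMSEQ_le[OF l1 tendsto_exp[OF l3]]) (use polynomial_Jensen[OF e z] in auto)
qed

text \<open>All three come from letting \<open>e\<close> tend to 0 in \<open>H2_Jensen_eps\<close>.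
  At a point where the extension is nonzero the left-hand side has a finite logarithm. A zero set of
  positive measure would drive the right-hand side to minus infinity, and Fatou bounds the negative
  part of the log modulus.\<close>

lemma
  assumes a: "H2 a" and nz: "\<not> (AE t in TT. a t = 0)"
  shows H2_nonzero_AE: "AE t in TT. a t \<noteq> 0"
    and H2_integrable_ln: "integrable TT (\<lambda>t. ln (norm (a t)))"
    and H2_Jensen: "norm z < 1 \<Longrightarrow> norm (hser a z) \<le> exp (pint (\<lambda>t. ln (norm (a t))) z)"
proof -
  have ai: "integrable TT a" by (rule L2_integrable[OF H2_L2[OF a]])
  have [measurable]: "a \<in> borel_measurable TT" using ai by auto
  have ni: "integrable TT (\<lambda>t. norm (a t))" using ai by auto
  have Jl: "ln (norm (hser a z)) \<le> pint (\<lambda>t. ln (norm (a t) + e)) z"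
    if "norm z < 1" "hser a z \<noteq> 0" "e > 0" for z e
    using H2_Jensen_eps[OF a that(3,1)] that(2) by (metis exp_gt_zero ln_exp ln_le_cancel_iff zero_less_norm_iff)
  have lnle: "ln (x + e) \<le> x" if "0 \<le> x" "0 < e" "e \<le> 1" for x e :: real
    using ln_le_minus_one[of "x + e"] that by auto
  obtain z0 where z0: "norm z0 < 1" "hser a z0 \<noteq> 0" by (rule H2_nonzero_hser[OF a nz])
  define Z where "Z t = (if a t = 0 then 1 else 0 :: real)" for t
  have Zm [measurable]: "Z \<in> borel_measurable TT" unfolding Z_def by measurable
  have Zi: "integrable TT Z" by (rule integrable_TT_bounded[OF Zm, of 1]) (auto simp: Z_def)
  define \<kappa> where "\<kappa> = pint Z z0"
  have "\<kappa> \<ge> 0"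
    using pint_mono_AE[OF integrable_TT_const[of 0] Zi z0(1)] pint_const[OF z0(1), of 0] by (simp add: \<kappa>_def Z_def)
  have est: "ln (norm (hser a z0)) \<le> pint (\<lambda>t. norm (a t)) z0 + ln e * \<kappa>" if e: "0 < e" "e \<le> 1" for e
  proof -
    have "pint (\<lambda>t. ln (norm (a t) + e)) z0 \<le> pint (\<lambda>t. norm (a t) + ln e * Z t) z0"
    proof (rule pint_mono_AE[OF integrable_ln_add[OF ai e(1)] _ z0(1)])
      show "AE t in TT. ln (norm (a t) + e) \<le> norm (a t) + ln e * Z t"
        by (rule AE_I2) (use lnle[OF _ e] in \<open>auto simp: Z_def\<close>)
    qed (use ni Zi in auto)
    also have "\<dots> = pint (\<lambda>t. norm (a t)) z0 + ln e * \<kappa>"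
      unfolding \<kappa>_def by (subst pint_add) (use ni Zi z0 pint_cmult in auto)
    finally show ?thesis using Jl[OF z0 e(1)] by linarith
  qed
  have "\<kappa> = 0"
  proof (rule ccontr)
    assume "\<kappa> \<noteq> 0"
    with \<open>\<kappa> \<ge> 0\<close> have k: "\<kappa> > 0" by simp
    \<comment> \<open>\<open>L\<close> exceeds the gap that \<open>est\<close> allows, and
      \<open>e = exp (- L / \<kappa>)\<close> makes \<open>ln e * \<kappa> = - L\<close>.\<close>
    define L where "L = \<bar>pint (\<lambda>t. norm (a t)) z0\<bar> + \<bar>ln (norm (hser a z0))\<bar> + 1"
    have "L > 0" by (simp add: L_def add_nonneg_pos)
    with k have "exp (- L / \<kappa>) \<le> 1" by simp
    from est[OF _ this] k have "ln (norm (hser a z0)) \<le> pint (\<lambda>t. norm (a t)) z0 - L" by simp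
    then show False by (simp add: L_def abs_if split: if_splits)
  qed
  then have "integral\<^sup>L TT (\<lambda>t. pois z0 t * Z t) = 0" by (simp add: \<kappa>_def pint_def)
  then have "AE t in TT. pois z0 t * Z t = 0"
    by (subst (asm) integral_nonneg_eq_0_iff_AE[OF integrable_pois_mult[OF Zi z0(1)]])
       (use pois_pos[OF z0(1)] in \<open>auto simp: Z_def less_imp_le\<close>)
  then show AEnz: "AE t in TT. a t \<noteq> 0"
    by eventually_elim (use pois_pos[OF z0(1)] in \<open>auto simp: Z_def less_le split: if_splits\<close>)
  \<comment> \<open>Subtracting from |a| gives the sign that Fatou needs, since ln x \<le> x - 1; at
    zeros of \<open>a\<close> the convention \<open>ln 0 = 0\<close> gives 0.\<close>
  define v where "v t = norm (a t) - ln (norm (a t))" for t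
  have v0: "v t \<ge> 0" for t
    using ln_le_minus_one[of "norm (a t)"] by (cases "a t = 0") (auto simp: v_def)
  have key: "integrable TT (\<lambda>t. pois z t * v t) \<and>
      integral\<^sup>L TT (\<lambda>t. pois z t * v t) \<le> 2 * pi * (pint (\<lambda>t. norm (a t)) z - ln (norm (hser a z)))"
    if z: "norm z < 1" and hz: "hser a z \<noteq> 0" for z
  proof -
    let ?e = "\<lambda>k. inverse (real (Suc k))"
    let ?u = "\<lambda>k t. pois z t * (norm (a t) - ln (norm (a t) + ?e k))"
    have ek: "0 < ?e k" "?e k \<le> 1" for k by (auto simp: field_simps)
    have ui: "integrable TT (?u k)" for k
      by (rule integrable_pois_mult[OF _ z]) (use ni integrable_ln_add[OF ai ek(1)] in auto)
    have u0: "0 \<le> ?u k t" for k t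
      using lnle[OF norm_ge_zero ek, of "a t" k] pois_pos[OF z, of t] by simp
    have ub: "integral\<^sup>L TT (?u k) \<le> 2 * pi * (pint (\<lambda>t. norm (a t)) z - ln (norm (hser a z)))" for k
    proof -
      have "integral\<^sup>L TT (?u k) = 2 * pi * pint (\<lambda>t. norm (a t) - ln (norm (a t) + ?e k)) z"
        by (simp add: pint_def)
      also have "\<dots> = 2 * pi * (pint (\<lambda>t. norm (a t)) z - pint (\<lambda>t. ln (norm (a t) + ?e k)) z)"
        by (subst pint_diff[OF ni integrable_ln_add[OF ai ek(1)] z]) simp
      also have "\<dots> \<le> 2 * pi * (pint (\<lambda>t. norm (a t)) z - ln (norm (hser a z)))"
        using Jl[OF z hz ek(1)[of k]] by (intro mult_left_mono) auto
      finally show ?thesis .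
    qed
    have ul: "AE t in TT. (\<lambda>k. ?u k t) \<longlonglongrightarrow> pois z t * v t"
      using AEnz
    proof eventually_elim
      case (elim t)
      have "(\<lambda>k. pois z t * (norm (a t) - ln (norm (a t) + ?e k))) \<longlonglongrightarrow>
          pois z t * (norm (a t) - ln (norm (a t) + 0))"
        by (intro tendsto_intros LIMSEQ_inverse_real_of_nat) (use elim in auto)
      then show ?case by (simp add: v_def)
    qed
    have vm: "(\<lambda>t. pois z t * v t) \<in> borel_measurable TT" unfolding v_def by measurable
    have vp: "0 \<le> pois z t * v t" for t using v0[of t] pois_pos[OF z, of t] by simp
    show ?thesis
      using Fatou_bound[where u = ?u, OF ui u0 always_eventually[OF allI[OF ub]] vm vp ul] by blast
  qed
  have vi: "integrable TT v"
  proof (rule Bochner_Integration.integrable_bound)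
    let ?k = "(1 - (norm z0)\<^sup>2) / 4"
    have kp: "?k > 0" using z0 by (simp add: abs_square_less_1)
    show "integrable TT (\<lambda>t. inverse ?k * (pois z0 t * v t))"
      using key[OF z0] by (intro integrable_mult_right) blast
    show "AE t in TT. norm (v t) \<le> norm (inverse ?k * (pois z0 t * v t))"
    proof (rule AE_I2)
      fix t
      have "?k * v t \<le> pois z0 t * v t" by (rule mult_right_mono[OF pois_ge[OF z0(1)] v0])
      then have "v t \<le> inverse ?k * (pois z0 t * v t)"
        using kp by (simp add: field_simps)
      then show "norm (v t) \<le> norm (inverse ?k * (pois z0 t * v t))"
        using v0[of t] abs_ge_self[of "inverse ?k * (pois z0 t * v t)"]
        unfolding real_norm_def by linarith
    qed
    show "v \<in> borel_measurable TT" unfolding v_def by measurable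
  qed
  have "integrable TT (\<lambda>t. norm (a t) - v t)" using ni vi by auto
  then show li: "integrable TT (\<lambda>t. ln (norm (a t)))" by (simp add: v_def)
  show "norm (hser a z) \<le> exp (pint (\<lambda>t. ln (norm (a t))) z)" if z: "norm z < 1"
  proof (cases "hser a z = 0")
    case False
    have "pint v z \<le> pint (\<lambda>t. norm (a t)) z - ln (norm (hser a z))"
      unfolding pint_def[of v] using key[OF z False] by (simp add: pos_divide_le_eq mult.commute)
    moreover have "pint v z = pint (\<lambda>t. norm (a t)) z - pint (\<lambda>t. ln (norm (a t))) z"
      unfolding v_def by (rule pint_diff[OF ni li z])
    ultimately have "ln (norm (hser a z)) \<le> pint (\<lambda>t. ln (norm (a t))) z" by linarith
    then show ?thesis using False by (metis exp_le_cancel_iff exp_ln zero_less_norm_iff)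
  qed simp
qed

subsection \<open>Outer functions\<close>

text \<open>Averaging the majorant over a circle of radius r gives the integral of \<open>m\<close>
  for every r, so Bessel bounds the Taylor coefficients uniformly. Letting r tend to 1 makes them
  square summable, and Riesz-Fischer supplies the boundary function.\<close>

lemma H2_of_holomorphic:
  assumes V: "V holomorphic_on ball 0 1" and m: "integrable TT m"
    and le: "\<And>z. norm z < 1 \<Longrightarrow> (norm (V z))\<^sup>2 \<le> pint m z"
  shows "\<exists>v. H2 v \<and> (\<forall>z. norm z < 1 \<longrightarrow> hser v z = V z) \<and> nsq v \<le> integral\<^sup>L TT m"
proof -
  define c where "c n = (deriv ^^ n) V 0 / fact n" for n
  have sums: "(\<lambda>n. c n * z ^ n) sums V z" if "norm z < 1" for z
    using holomorphic_power_series[OF V, of z] that by (simp add: c_def)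
  have bound: "(\<Sum>n<N. (norm (c n * of_real r ^ n))\<^sup>2) \<le> integral\<^sup>L TT m / (2*pi)" if r: "0 \<le> r" "r < 1" for r N
  proof -
    define d where "d n = c n * complex_of_real r ^ n" for n
    define w where "w t = V (of_real r * cis t)" for t
    have rn: "norm (complex_of_real r * cis t) < 1" for t using r by simp
    have sd: "summable (\<lambda>n. norm (d n))"
    proof -
      \<comment> \<open>Convergence at the larger radius \<open>r'\<close> gives absolute
        convergence at \<open>r\<close>, hence one constant dominating all partial sums on that
        circle.\<close>
      obtain r' where r': "r < r'" "r' < 1" using dense r by blast
      then have "summable (\<lambda>n. c n * of_real r' ^ n)" using sums[of "of_real r'"] r by (auto simp: sums_iff)
      then show ?thesis unfolding d_def by (rule powser_insidea) (use r r' in auto)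
    qed
    have wl: "(\<lambda>N. tpoly d N t) \<longlonglongrightarrow> w t" for t
    proof -
      have "tpoly d N t = (\<Sum>n<N. c n * (of_real r * cis t) ^ n)" for N
        unfolding tpoly_def d_def by (intro sum.cong refl) (simp add: power_mult_distrib Complex.DeMoivre)
      then show ?thesis using sums[OF rn[of t]] by (simp add: sums_def w_def)
    qed
    have tb: "norm (tpoly d N t) \<le> (\<Sum>n. norm (d n))" for N t
      by (rule order_trans[OF norm_tpoly_le]) (intro sum_le_suminf sd, auto)
    have wm [measurable]: "w \<in> borel_measurable TT"
      by (rule borel_measurable_LIMSEQ_metric[OF tpoly_measurable wl])
    have wb: "norm (w t) \<le> (\<Sum>n. norm (d n))" for t
      by (rule LIMSEQ_le_const2[OF tendsto_norm[OF wl]]) (use tb in auto)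
    have wL: "L2 w" by (rule L2_bounded[OF wm wb])
    have fc: "fcoeff w (int n) = d n" for n
    proof -
      have "(\<lambda>N. fcoeff (tpoly d N) (int n)) \<longlonglongrightarrow> fcoeff w (int n)"
        unfolding fcoeff_def
      proof (rule tendsto_divide[OF _ tendsto_const])
        show "(\<lambda>N. \<integral>t. tpoly d N t * cis (- (of_int (int n) * t)) \<partial>TT) \<longlonglongrightarrow>
            (\<integral>t. w t * cis (- (of_int (int n) * t)) \<partial>TT)"
        proof (rule integral_dominated_convergence[where w = "\<lambda>_. \<Sum>n. norm (d n)"])
          show "AE t in TT. (\<lambda>N. tpoly d N t * cis (- (of_int (int n) * t))) \<longlonglongrightarrow>
              w t * cis (- (of_int (int n) * t))"
            by (intro AE_I2 tendsto_mult wl tendsto_const)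
          show "AE t in TT. norm (tpoly d N t * cis (- (of_int (int n) * t))) \<le> (\<Sum>n. norm (d n))" for N
            using tb by (auto simp: norm_mult)
        qed (use integrable_TT_const in \<open>auto simp del: of_int_of_nat_eq\<close>)
      qed simp
      moreover have "(\<lambda>N. fcoeff (tpoly d N) (int n)) \<longlonglongrightarrow> d n"
        by (rule tendsto_eventually, rule eventually_mono[OF eventually_gt_at_top[of n]]) (auto simp: fcoeff_tpoly)
      ultimately show ?thesis by (rule LIMSEQ_unique)
    qed
    have "0 \<le> nsq w - 2 * pi * (\<Sum>n<N. (norm (fcoeff w (int n)))\<^sup>2)"
      by (subst nsq_diff_tpoly[OF wL, symmetric]) simp
    then have "2 * pi * (\<Sum>n<N. (norm (d n))\<^sup>2) \<le> nsq w"
      unfolding fc by simp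
    also have "\<dots> \<le> integral\<^sup>L TT (\<lambda>t. pint m (of_real r * cis t))"
    proof (rule integral_mono)
      show "integrable TT (\<lambda>t. (norm (w t))\<^sup>2)" using wL by (simp add: L2_def)
      show "(norm (w t))\<^sup>2 \<le> pint m (of_real r * cis t)" for t
        unfolding w_def by (rule le[OF rn])
    qed (rule integrable_pint_circle[OF m r])
    also have "\<dots> = integral\<^sup>L TT m" by (rule integral_pint_circle[OF m r])
    finally show ?thesis by (simp add: d_def field_simps)
  qed
  have b1: "(\<Sum>n<N. (norm (c n))\<^sup>2) \<le> integral\<^sup>L TT m / (2*pi)" for N
  proof -
    have "(\<lambda>j. \<Sum>n<N. (norm (c n * of_real (rad j) ^ n))\<^sup>2) \<longlonglongrightarrow> (\<Sum>n<N. (norm (c n * of_real 1 ^ n))\<^sup>2)"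
      by (intro tendsto_intros rad_LIMSEQ)
    then have "(\<Sum>n<N. (norm (c n * of_real 1 ^ n))\<^sup>2) \<le> integral\<^sup>L TT m / (2*pi)"
      by (rule LIMSEQ_le_const2) (use bound[OF rad] in blast)
    then show ?thesis by simp
  qed
  have sc: "summable (\<lambda>n. (norm (c n))\<^sup>2)"
    by (rule summableI_nonneg_bounded[OF _ b1]) simp
  obtain v where v: "L2 v" and vc: "\<forall>n. fcoeff v n = (if n < 0 then 0 else c (nat n))"
    using Riesz_Fischer[OF sc] by auto
  have vH: "H2 v" using v vc by (simp add: H2_def)
  have vn: "fcoeff v (int n) = c n" for n using vc by simp
  have "hser v z = V z" if "norm z < 1" for z
    unfolding hser_def vn using sums_unique[OF sums[OF that]] by simp
  moreover have "nsq v \<le> integral\<^sup>L TT m"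
  proof -
    have "(\<lambda>n. (norm (c n))\<^sup>2) sums (nsq v / (2*pi))"
      using H2_Parseval[OF vH] unfolding vn .
    then have "nsq v / (2*pi) \<le> integral\<^sup>L TT m / (2*pi)"
      unfolding sums_def by (rule LIMSEQ_le_const2) (use b1 in blast)
    then show ?thesis by (simp add: divide_le_cancel)
  qed
  ultimately show ?thesis using vH by blast
qed

lemma outer_iff:
  "outer p \<longleftrightarrow> H2 p \<and> (AE t in TT. p t \<noteq> 0) \<and> integrable TT (\<lambda>t. ln (norm (p t))) \<and>
     (\<exists>\<alpha>. norm \<alpha> = 1 \<and> (\<forall>z. norm z < 1 \<longrightarrow> hser p z = \<alpha> * exp (herg (\<lambda>t. ln (norm (p t))) z)))"
  unfolding outer_def hser_def herg_def hkernel_def ..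

lemma norm_outer_hser:
  assumes "outer p" "norm z < 1"
  shows "norm (hser p z) = exp (pint (\<lambda>t. ln (norm (p t))) z)"
  using assms Re_herg[of "\<lambda>t. ln (norm (p t))" z] unfolding outer_iff by (auto simp: norm_mult)

lemma outer_not_AE_zero:
  assumes "outer p"
  shows "\<not> (AE t in TT. p t = 0)"
proof
  assume *: "AE t in TT. p t = 0"
  have "p \<in> borel_measurable TT" using assms by (simp add: outer_def H2_def L2_def)
  then have "hser p 0 = hser (\<lambda>_. 0) 0" by (rule hser_cong_AE[OF _ _ *]) auto
  also have "\<dots> = 0" by (simp add: hser_def fcoeff_def)
  finally show False using norm_outer_hser[OF assms, of 0] by simp
qed

text \<open>The candidate is the exponential of the Herglotz integral of ln |q|. Convexity applied
  to 2 ln |q| gives |q|^2 as majorant, so its norm is at most that of \<open>q\<close>.\<close>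

theorem outer_exists:
  assumes q: "H2 q" and nz: "\<not> (AE t in TT. q t = 0)"
  shows "\<exists>p. outer p \<and> (AE t in TT. norm (p t) = norm (q t)) \<and>
    (\<forall>z. norm z < 1 \<longrightarrow> hser p z = exp (herg (\<lambda>t. ln (norm (q t))) z))"
proof -
  let ?l = "\<lambda>t. ln (norm (q t))"
  note qnz = H2_nonzero_AE[OF q nz]
  note qi = H2_integrable_ln[OF q nz]
  have q2: "integrable TT (\<lambda>t. (norm (q t))\<^sup>2)" using q by (simp add: H2_def L2_def)
  have qm [measurable]: "q \<in> borel_measurable TT" using q by (simp add: H2_def L2_def)
  have ae: "AE t in TT. exp (2 * ?l t) = (norm (q t))\<^sup>2"
    using qnz by eventually_elim (simp add: exp_double)
  have qe: "integrable TT (\<lambda>t. exp (2 * ?l t))"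
    using q2 integrable_cong_AE[OF _ _ ae] by simp
  let ?V = "\<lambda>z. exp (herg ?l z)"
  have Vn: "norm (?V z) = exp (pint ?l z)" if "norm z < 1" for z
    using Re_herg[OF qi that] by simp
  have "\<exists>p. H2 p \<and> (\<forall>z. norm z < 1 \<longrightarrow> hser p z = ?V z) \<and> nsq p \<le> nsq q"
  proof (rule H2_of_holomorphic)
    show "?V holomorphic_on ball 0 1" by (intro holomorphic_intros herg_holomorphic qi)
    show "(norm (?V z))\<^sup>2 \<le> pint (\<lambda>t. (norm (q t))\<^sup>2) z" if z: "norm z < 1" for z
    proof -
      have "(norm (?V z))\<^sup>2 = exp (pint (\<lambda>t. 2 * ?l t) z)"
        unfolding Vn[OF z] pint_cmult by (simp add: exp_double)
      also have "\<dots> \<le> pint (\<lambda>t. exp (2 * ?l t)) z"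
        by (rule exp_pint_le) (use qi qe z in auto)
      also have "\<dots> = pint (\<lambda>t. (norm (q t))\<^sup>2) z"
        by (rule pint_cong_AE[OF _ _ ae]) measurable
      finally show ?thesis .
    qed
  qed (rule q2)
  then obtain p where p: "H2 p" and ph: "\<And>z. norm z < 1 \<Longrightarrow> hser p z = ?V z" and pn: "nsq p \<le> nsq q"
    by auto
  have pm [measurable]: "p \<in> borel_measurable TT" using p by (simp add: H2_def L2_def)
  have pnz: "\<not> (AE t in TT. p t = 0)"
  proof
    assume "AE t in TT. p t = 0"
    then have "hser p 0 = hser (\<lambda>_. 0) 0" by (intro hser_cong_AE) auto
    then show False using ph[of 0] by (simp add: hser_def fcoeff_def)
  qed
  note pnzA = H2_nonzero_AE[OF p pnz]
  note pi' = H2_integrable_ln[OF p pnz]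
  \<comment> \<open>Jensen is applied to \<open>p\<close>, whose extension has modulus exactly the
    exponential of the Poisson integral of ln |q|; the comparison of Poisson integrals then passes
    to the boundary.\<close>
  have "AE t in TT. ln (norm (p t)) - ?l t \<ge> 0"
  proof (rule nonneg_AE_if_pint_nonneg)
    show "integrable TT (\<lambda>t. ln (norm (p t)) - ?l t)" using pi' qi by auto
    fix z :: complex assume z: "norm z < 1"
    have "exp (pint ?l z) \<le> exp (pint (\<lambda>t. ln (norm (p t))) z)"
      using H2_Jensen[OF p pnz z] ph[OF z] Vn[OF z] by simp
    then show "pint (\<lambda>t. ln (norm (p t)) - ?l t) z \<ge> 0"
      using pint_diff[OF pi' qi z] by simp
  qed
  then have ge: "AE t in TT. (norm (p t))\<^sup>2 - (norm (q t))\<^sup>2 \<ge> 0"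
    using pnzA qnz by eventually_elim (simp add: power_mono)
  have p2: "integrable TT (\<lambda>t. (norm (p t))\<^sup>2)" using p by (simp add: H2_def L2_def)
  have i: "integrable TT (\<lambda>t. (norm (p t))\<^sup>2 - (norm (q t))\<^sup>2)" using p2 q2 by auto
  have "integral\<^sup>L TT (\<lambda>t. (norm (p t))\<^sup>2 - (norm (q t))\<^sup>2) = 0"
    using integral_nonneg_AE[OF ge] pn p2 q2 by simp
  then have "AE t in TT. (norm (p t))\<^sup>2 - (norm (q t))\<^sup>2 = 0"
    using integral_nonneg_eq_0_iff_AE[OF i ge] by simp
  then have eq: "AE t in TT. norm (p t) = norm (q t)"
    by eventually_elim (simp add: power2_eq_iff_nonneg)
  have hl: "herg (\<lambda>t. ln (norm (p t))) z = herg ?l z" for z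
    unfolding herg_def
    by (intro arg_cong2[where f = "(/)"] refl integral_cong_AE) (use eq in \<open>auto\<close>)
  have "outer p"
    unfolding outer_iff using p pnzA pi' ph hl by (auto intro!: exI[of _ 1])
  then show ?thesis using eq ph by blast
qed

text \<open>In the disc the quotient is bounded by Jensen for \<open>q\<close> and \<open>h\<close>
  and by equality for the outer \<open>p\<close>, so its modulus is at most the exponential of the
  Poisson integral of ln |v|. Convexity makes |v|^2 a majorant.\<close>

lemma Smirnov:
  assumes q: "H2 q" and h: "H2 h" and p: "outer p"
    and v: "L2 v" and eq: "AE t in TT. v t * p t = q t * h t"
  shows "H2 v"
proof -
  have pH: "H2 p" and pnz: "AE t in TT. p t \<noteq> 0" and pl: "integrable TT (\<lambda>t. ln (norm (p t)))"
    using p by (auto simp: outer_iff)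
  have [measurable]: "q \<in> borel_measurable TT" "h \<in> borel_measurable TT" "p \<in> borel_measurable TT" "v \<in> borel_measurable TT"
    using q h pH v by (auto simp: H2_def L2_def)
  show ?thesis
  \<comment> \<open>Jensen needs nonzero factors; if one vanishes a.e., so does \<open>v\<close>, as
    \<open>p\<close> is nonzero a.e.\<close>
  proof (cases "(AE t in TT. q t = 0) \<or> (AE t in TT. h t = 0)")
    case True
    then have "AE t in TT. q t * h t = 0" by (auto elim: eventually_mono)
    with eq pnz have "AE t in TT. 0 = v t" by eventually_elim auto
    moreover have "H2 (\<lambda>_. 0)" by (auto simp: H2_def fcoeff_def intro: L2_bounded[of _ 0])
    ultimately show ?thesis by (intro H2_cong_AE[of "\<lambda>_. 0" v]) auto
  next
    case False
    note qq = H2_nonzero_AE[OF q] H2_integrable_ln[OF q] H2_Jensen[OF q]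
    note hh = H2_nonzero_AE[OF h] H2_integrable_ln[OF h] H2_Jensen[OF h]
    let ?l = "\<lambda>f t. ln (norm (f t :: complex))"
    have v2: "integrable TT (\<lambda>t. (norm (v t))\<^sup>2)" using v by (simp add: L2_def)
    have li: "integrable TT (\<lambda>t. ?l q t + ?l h t - ?l p t)"
      using qq(2) hh(2) pl False by auto
    have ae: "AE t in TT. exp (2 * (?l q t + ?l h t - ?l p t)) = (norm (v t))\<^sup>2"
    proof -
      have "AE t in TT. q t \<noteq> 0" "AE t in TT. h t \<noteq> 0" using qq(1) hh(1) False by auto
      with eq pnz show ?thesis
      proof eventually_elim
        case (elim t)
        then have "norm (v t) = norm (q t) * norm (h t) / norm (p t)"
          by (simp add: field_simps flip: norm_mult)
        then show ?case using elim by (simp add: exp_double exp_add exp_diff power_divide power_mult_distrib)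
      qed
    qed
    define V where "V z = hser q z * hser h z / hser p z" for z
    have p0: "hser p z \<noteq> 0" if "norm z < 1" for z using norm_outer_hser[OF p that] by auto
    have "\<exists>w. H2 w \<and> (\<forall>z. norm z < 1 \<longrightarrow> hser w z = V z) \<and> nsq w \<le> nsq v"
    proof (rule H2_of_holomorphic)
      show "V holomorphic_on ball 0 1"
        unfolding V_def
        by (intro holomorphic_intros hser_holomorphic L2_integrable H2_L2 q h pH) (use p0 in auto)
      show "(norm (V z))\<^sup>2 \<le> pint (\<lambda>t. (norm (v t))\<^sup>2) z" if z: "norm z < 1" for z
      proof -
        have "norm (V z) \<le> exp (pint (?l q) z) * exp (pint (?l h) z) / exp (pint (?l p) z)"
          unfolding V_def norm_mult norm_divide norm_outer_hser[OF p z]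
          using qq(3) hh(3) False z by (intro divide_right_mono mult_mono) auto
        also have "\<dots> = exp (pint (\<lambda>t. ?l q t + ?l h t - ?l p t) z)"
          using qq(2) hh(2) pl False z by (subst pint_diff) (auto simp: pint_add exp_add exp_diff)
        finally have "(norm (V z))\<^sup>2 \<le> (exp (pint (\<lambda>t. ?l q t + ?l h t - ?l p t) z))\<^sup>2"
          by (intro power_mono) auto
        also have "\<dots> = exp (pint (\<lambda>t. 2 * (?l q t + ?l h t - ?l p t)) z)"
          unfolding pint_cmult by (simp add: exp_double)
        also have "\<dots> \<le> pint (\<lambda>t. exp (2 * (?l q t + ?l h t - ?l p t))) z"
        proof (rule exp_pint_le[OF _ _ z])
          show "integrable TT (\<lambda>t. 2 * (?l q t + ?l h t - ?l p t))"
            by (rule integrable_mult_right) (rule li)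
          show "integrable TT (\<lambda>t. exp (2 * (?l q t + ?l h t - ?l p t)))"
            using v2 integrable_cong_AE[OF _ _ ae] by simp
        qed
        also have "\<dots> = pint (\<lambda>t. (norm (v t))\<^sup>2) z"
          by (rule pint_cong_AE[OF _ _ ae]) measurable
        finally show ?thesis .
      qed
    qed (rule v2)
    then obtain w where w: "H2 w" and wV: "\<And>z. norm z < 1 \<Longrightarrow> hser w z = V z" by auto
    have [measurable]: "w \<in> borel_measurable TT" using w by (auto simp: H2_def L2_def)
    \<comment> \<open>Cleared of its denominator, the disc identity involves only products of
      \<open>H2\<close> functions, whose extensions multiply; uniqueness carries it to the
      circle.\<close>
    have "AE t in TT. w t * p t = q t * h t"
    proof (rule AE_eq_if_hser_eq)
      show "integrable TT (\<lambda>t. w t * p t)" "integrable TT (\<lambda>t. q t * h t)"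
        by (intro L2_mult_integrable H2_L2 w pH q h)+
      show "fcoeff (\<lambda>t. w t * p t) n = 0" "fcoeff (\<lambda>t. q t * h t) n = 0" if "n < 0" for n
        using that by (simp_all add: fcoeff_H2_mult w pH q h)
      show "hser (\<lambda>t. w t * p t) z = hser (\<lambda>t. q t * h t) z" if z: "norm z < 1" for z
        using p0[OF z] by (simp add: hser_mult w pH q h z wV[OF z] V_def)
    qed
    with eq pnz have "AE t in TT. w t = v t"
      by eventually_elim (metis mult_right_cancel)
    then show ?thesis by (intro H2_cong_AE[OF w]) auto
  qed
qed

subsection \<open>Maximal vectors of Toeplitz kernels\<close>

text \<open>The conjugation \<open>f \<mapsto> cnj (z f)\<close>, which exchanges \<open>H\<^sup>2\<close> and its orthogonal complement.\<close>

definition cshift :: "(real \<Rightarrow> complex) \<Rightarrow> real \<Rightarrow> complex" where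
  "cshift f t = cis (- t) * cnj (f t)"

lemma cshift_cshift [simp]: "cshift (cshift f) = f"
  by (rule ext) (simp add: cshift_def cis_cnj cis_mult flip: mult.assoc)

lemma norm_cshift [simp]: "norm (cshift f t) = norm (f t)"
  by (simp add: cshift_def norm_mult)

lemma cshift_measurable [measurable]: "f \<in> borel_measurable TT \<Longrightarrow> cshift f \<in> borel_measurable TT"
  unfolding cshift_def by measurable

lemma cshift_L2: "L2 f \<Longrightarrow> L2 (cshift f)"
  by (rule L2_cong_AE[of f]) (simp_all add: L2_measurable cshift_measurable)

lemma H2_0_conj_iff: "H2_0_conj f \<longleftrightarrow> H2 (cshift f)"
proof -
  have "L2 f \<longleftrightarrow> L2 (cshift f)" using cshift_L2[of f] cshift_L2[of "cshift f"] by auto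
  moreover have "(\<forall>n\<ge>0. fcoeff f n = 0) \<longleftrightarrow> (\<forall>n<0. fcoeff (cshift f) n = 0)"
  proof -
    have r: "fcoeff (cshift f) n = cnj (fcoeff f (- n - 1))" for n
      unfolding cshift_def by (rule fcoeff_cis_mult_cnj)
    show ?thesis
    proof
      assume *: "\<forall>n<0. fcoeff (cshift f) n = 0"
      show "\<forall>n\<ge>0. fcoeff f n = 0"
      proof (intro allI impI)
        fix n :: int assume "n \<ge> 0"
        then show "fcoeff f n = 0" using *[rule_format, of "- n - 1"] by (simp add: r)
      qed
    qed (auto simp: r)
  qed
  ultimately show ?thesis by (simp add: H2_0_conj_def H2_def)
qed

lemma toeplitz_kernel_iff: "f \<in> toeplitz_kernel g \<longleftrightarrow> H2 f \<and> H2 (cshift (\<lambda>t. g t * f t))"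
  by (simp add: toeplitz_kernel_def H2_0_conj_iff)

lemma Linf_mult_L2:
  assumes g: "Linf g" and f: "L2 f"
  shows "L2 (\<lambda>t. g t * f t)"
proof -
  obtain C where C: "AE t in TT. norm (g t) \<le> C" and gm [measurable]: "g \<in> borel_measurable TT"
    using g by (auto simp: Linf_def)
  have [measurable]: "f \<in> borel_measurable TT" by (rule L2_measurable[OF f])
  have "integrable TT (\<lambda>t. (norm (g t * f t))\<^sup>2)"
  proof (rule Bochner_Integration.integrable_bound)
    show "integrable TT (\<lambda>t. C\<^sup>2 * (norm (f t))\<^sup>2)" using f by (auto simp: L2_def)
    show "AE t in TT. norm ((norm (g t * f t))\<^sup>2) \<le> norm (C\<^sup>2 * (norm (f t))\<^sup>2)"
      using C
    proof eventually_elim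
      case (elim t)
      then have "(norm (g t))\<^sup>2 \<le> C\<^sup>2" by (intro power_mono) auto
      then show ?case by (simp add: norm_mult power_mult_distrib mult_right_mono)
    qed
  qed measurable
  then show ?thesis by (simp add: L2_def)
qed

text \<open>\<open>g f\<close> is, up to conjugation and a shift, an \<open>H2\<close> function, so
  it is nonzero a.e. or zero a.e. In the latter case \<open>f \<noteq> 0\<close> a.e. would force
  \<open>g = 0\<close> a.e.\<close>

lemma symbol_nonzero_AE:
  assumes g: "\<not> (AE t in TT. g t = 0)"
    and f: "f \<in> toeplitz_kernel g" "\<not> (AE t in TT. f t = 0)"
  shows "AE t in TT. g t \<noteq> 0"
proof -
  have fH: "H2 f" and qH: "H2 (cshift (\<lambda>t. g t * f t))" using f(1) by (auto simp: toeplitz_kernel_iff)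
  have fnz: "AE t in TT. f t \<noteq> 0" by (rule H2_nonzero_AE[OF fH f(2)])
  have "\<not> (AE t in TT. cshift (\<lambda>t. g t * f t) t = 0)"
  proof
    assume "AE t in TT. cshift (\<lambda>t. g t * f t) t = 0"
    with fnz have "AE t in TT. g t = 0" by eventually_elim (auto simp: cshift_def)
    with g show False by simp
  qed
  from H2_nonzero_AE[OF qH this] show ?thesis
    by eventually_elim (auto simp: cshift_def)
qed

lemma maximal_vector_if_outer:
  assumes g: "Linf g" and gnz: "AE t in TT. g t \<noteq> 0" and k: "H2 k" and p: "outer p"
    and eq: "AE t in TT. k t = cis (- t) * cnj (p t) / g t"
  shows "maximal_vector g k"
proof -
  have gm [measurable]: "g \<in> borel_measurable TT" using g by (simp add: Linf_def)
  have km [measurable]: "k \<in> borel_measurable TT" by (rule L2_measurable[OF H2_L2[OF k]])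
  have pH: "H2 p" using p by (simp add: outer_def)
  have pe: "AE t in TT. p t = cshift (\<lambda>t. g t * k t) t"
    using gnz eq by eventually_elim (simp add: cshift_def cis_cnj cis_mult flip: mult.assoc)
  have knz: "\<not> (AE t in TT. k t = 0)"
  proof
    assume "AE t in TT. k t = 0"
    with pe have "AE t in TT. p t = 0" by eventually_elim (simp add: cshift_def)
    with outer_not_AE_zero[OF p] show False by simp
  qed
  have kk: "k \<in> toeplitz_kernel g"
    unfolding toeplitz_kernel_iff using k H2_cong_AE[OF pH _ pe] by simp
  have "toeplitz_kernel g \<subseteq> toeplitz_kernel w" if w: "Linf w" and kw: "k \<in> toeplitz_kernel w" for w
  proof
    fix f assume "f \<in> toeplitz_kernel g"
    then have f: "H2 f" and h: "H2 (cshift (\<lambda>t. g t * f t))" by (auto simp: toeplitz_kernel_iff)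
    have q: "H2 (cshift (\<lambda>t. w t * k t))" using kw by (simp add: toeplitz_kernel_iff)
    have "H2 (cshift (\<lambda>t. w t * f t))"
    \<comment> \<open>The required identity is (w f)(g k) = (w k)(g f) after conjugation, with
      \<open>p\<close> standing for the shifted conjugate of \<open>g k\<close>.\<close>
    proof (rule Smirnov[OF q h p cshift_L2[OF Linf_mult_L2[OF w H2_L2[OF f]]]])
      show "AE t in TT. cshift (\<lambda>t. w t * f t) t * p t = cshift (\<lambda>t. w t * k t) t * cshift (\<lambda>t. g t * f t) t"
        using pe by eventually_elim (simp add: cshift_def)
    qed
    with f show "f \<in> toeplitz_kernel w" by (simp add: toeplitz_kernel_iff)
  qed
  then show ?thesis
    unfolding maximal_vector_def is_min_toeplitz_kernel_def is_toeplitz_kernel_def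
    using k knz kk g by blast
qed

lemma outer_if_maximal_vector:
  assumes g: "Linf g" and gnz: "AE t in TT. g t \<noteq> 0" and max: "maximal_vector g k"
  shows "outer (cshift (\<lambda>t. g t * k t))"
proof -
  define q where "q = cshift (\<lambda>t. g t * k t)"
  have k: "H2 k" and knz: "\<not> (AE t in TT. k t = 0)" and kk: "k \<in> toeplitz_kernel g"
    and min: "\<And>w. Linf w \<Longrightarrow> k \<in> toeplitz_kernel w \<Longrightarrow> toeplitz_kernel g \<subseteq> toeplitz_kernel w"
    using max unfolding maximal_vector_def is_min_toeplitz_kernel_def by blast+
  have q: "H2 q" using kk by (simp add: toeplitz_kernel_iff q_def)
  have qt: "q t = cis (- t) * (cnj (g t) * cnj (k t))" for t by (simp add: q_def cshift_def)
  have qnz: "\<not> (AE t in TT. q t = 0)"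
  proof
    assume "AE t in TT. q t = 0"
    with gnz have "AE t in TT. k t = 0" by eventually_elim (simp add: qt)
    with knz show False by simp
  qed
  note qnzA = H2_nonzero_AE[OF q qnz]
  obtain p where p: "outer p" and pq: "AE t in TT. norm (p t) = norm (q t)"
    and ph: "\<And>z. norm z < 1 \<Longrightarrow> hser p z = exp (herg (\<lambda>t. ln (norm (q t))) z)"
    using outer_exists[OF q qnz] by blast
  have pH: "H2 p" and pnz: "AE t in TT. p t \<noteq> 0" using p by (auto simp: outer_def)
  have m [measurable]: "g \<in> borel_measurable TT" "k \<in> borel_measurable TT" "q \<in> borel_measurable TT" "p \<in> borel_measurable TT"
    using g k q pH by (auto simp: Linf_def H2_def L2_def)
  define i where "i t = q t / p t" for t
  have im [measurable]: "i \<in> borel_measurable TT" unfolding i_def by measurable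
  have i1: "AE t in TT. norm (i t) = 1"
    using pq pnz
  proof eventually_elim
    case (elim t)
    have "norm (i t) = norm (p t) / norm (p t)" by (simp only: i_def norm_divide elim(1))
    with elim(2) show ?case by simp
  qed
  have iL: "Linf i" unfolding Linf_def
    using im i1 by (auto intro!: exI[of _ 1] elim: eventually_mono)
  \<comment> \<open>Equality of moduli, q conj q = p conj p, turns conj (q / p) into p / q.\<close>
  have icnj: "AE t in TT. cnj (i t) * q t = p t"
    using pq pnz
  proof eventually_elim
    case (elim t)
    have "cnj (i t) * q t = (q t * cnj (q t)) / cnj (p t)" by (simp add: i_def)
    also have "q t * cnj (q t) = p t * cnj (p t)"
      using elim by (simp flip: complex_norm_square)
    finally show ?case using elim by simp
  qed
  define w where "w t = g t * i t" for t
  have wL: "Linf w"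
  proof -
    obtain C where C: "AE t in TT. norm (g t) \<le> C" using g by (auto simp: Linf_def)
    have "AE t in TT. norm (w t) \<le> C"
      using C i1 by eventually_elim (simp add: w_def norm_mult)
    moreover have "w \<in> borel_measurable TT" unfolding w_def by measurable
    ultimately show ?thesis by (auto simp: Linf_def)
  qed
  have wm [measurable]: "w \<in> borel_measurable TT" using wL by (simp add: Linf_def)
  have "AE t in TT. p t = cshift (\<lambda>t. w t * k t) t"
    using icnj by eventually_elim (simp add: cshift_def w_def qt mult_ac)
  then have wk: "H2 (cshift (\<lambda>t. w t * k t))" by (rule H2_cong_AE[OF pH, rotated]) measurable
  then have "toeplitz_kernel g \<subseteq> toeplitz_kernel w"
    using min[OF wL] k by (simp add: toeplitz_kernel_iff)
  \<comment> \<open>\<open>i k = q k / p\<close> is in \<open>H2\<close> by Smirnov, and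
    \<open>g (i k) = w k\<close> is already known to have the right conjugate.\<close>
  moreover have "(\<lambda>t. i t * k t) \<in> toeplitz_kernel g"
  proof -
    have "H2 (\<lambda>t. i t * k t)"
      by (rule Smirnov[OF q k p Linf_mult_L2[OF iL H2_L2[OF k]]])
         (use pnz in eventually_elim, simp add: i_def)
    moreover have "(\<lambda>t. w t * k t) = (\<lambda>t. g t * (i t * k t))" by (auto simp: w_def)
    ultimately show ?thesis using wk by (simp add: toeplitz_kernel_iff)
  qed
  ultimately have "(\<lambda>t. i t * k t) \<in> toeplitz_kernel w" by blast
  \<comment> \<open>This \<open>?r\<close> is p^2 / q: the symbol times vector is g k i^2, and
    conjugation produces q (p / q)^2.\<close>
  then have rH: "H2 (cshift (\<lambda>t. w t * (i t * k t)))" (is "H2 ?r") by (simp add: toeplitz_kernel_iff)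
  have req: "AE t in TT. q t * ?r t = p t * p t"
    using icnj
  proof eventually_elim
    case (elim t)
    have "q t * ?r t = (cnj (i t) * q t) * (cnj (i t) * q t)"
      by (simp add: cshift_def w_def qt mult_ac)
    with elim show ?case by simp
  qed
  \<comment> \<open>Equal boundary moduli mean that Jensen bounds both factors of
    \<open>hser p z * hser p z\<close> by |hser p z|, so neither bound can be strict.\<close>
  have rn: "AE t in TT. norm (?r t) = norm (q t)"
    using i1 by eventually_elim (simp add: w_def qt norm_mult)
  have rnz: "\<not> (AE t in TT. ?r t = 0)"
  proof
    assume "AE t in TT. ?r t = 0"
    with rn have "AE t in TT. q t = 0" by eventually_elim simp
    with qnz show False by simp
  qed
  have rm [measurable]: "?r \<in> borel_measurable TT" by (rule L2_measurable[OF H2_L2[OF rH]])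
  have norm_eq: "norm (hser q z) = norm (hser p z)" if z: "norm z < 1" for z
  proof -
    have pn: "norm (hser p z) = exp (pint (\<lambda>t. ln (norm (q t))) z)"
      using ph[OF z] Re_herg[OF H2_integrable_ln[OF q qnz] z] by simp
    have "hser q z * hser ?r z = hser p z * hser p z"
      unfolding hser_mult[OF q rH z, symmetric] hser_mult[OF pH pH z, symmetric]
      by (rule hser_cong_AE[OF _ _ req]) measurable
    then have e: "norm (hser q z) * norm (hser ?r z) = norm (hser p z) * norm (hser p z)"
      by (metis norm_mult)
    have le1: "norm (hser q z) \<le> norm (hser p z)"
      unfolding pn by (rule H2_Jensen[OF q qnz z])
    have "pint (\<lambda>t. ln (norm (?r t))) z = pint (\<lambda>t. ln (norm (q t))) z"
      by (rule pint_cong_AE) (use rn in \<open>measurable, eventually_elim, simp\<close>)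
    then have "norm (hser ?r z) \<le> norm (hser p z)"
      unfolding pn using H2_Jensen[OF rH rnz z] by simp
    then have "norm (hser p z) * norm (hser p z) \<le> norm (hser q z) * norm (hser p z)"
      unfolding e[symmetric] by (intro mult_left_mono) auto
    moreover have "norm (hser p z) > 0" unfolding pn by simp
    ultimately have "norm (hser p z) \<le> norm (hser q z)" by simp
    with le1 show ?thesis by simp
  qed
  have p0: "hser p z \<noteq> 0" if "norm z < 1" for z using ph[OF that] by simp
  \<comment> \<open>The quotient has modulus 1 throughout the disc, so its maximum is attained at
    the interior point 0.\<close>
  have "(\<lambda>z. hser q z / hser p z) constant_on ball 0 1"
  proof (rule maximum_modulus_principle[where U = "ball 0 1" and \<xi> = 0])
    show "(\<lambda>z. hser q z / hser p z) holomorphic_on ball 0 1"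
      by (intro holomorphic_intros hser_holomorphic L2_integrable H2_L2 q pH) (use p0 in auto)
    show "norm (hser q z / hser p z) \<le> norm (hser q 0 / hser p 0)" if "z \<in> ball 0 1" for z
      using that norm_eq[of z] norm_eq[of 0] p0[of z] p0[of 0] by (simp add: norm_divide)
  qed auto
  then obtain \<alpha> where al: "\<And>z. z \<in> ball 0 1 \<Longrightarrow> hser q z / hser p z = \<alpha>"
    unfolding constant_on_def by blast
  have "norm \<alpha> = 1"
    using al[of 0] norm_eq[of 0] p0[of 0] by (auto simp: norm_divide)
  moreover have "hser q z = \<alpha> * exp (herg (\<lambda>t. ln (norm (q t))) z)" if z: "norm z < 1" for z
    using al[of z] z p0[OF z] ph[OF z] by (auto simp: field_simps)
  ultimately have "outer q"
    unfolding outer_iff using q qnzA H2_integrable_ln[OF q qnz] by blast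
  then show ?thesis by (simp add: q_def)
qed

theorem mainTheorem2:
  fixes g :: "real \<Rightarrow> complex"
  assumes "Linf g"
    and "\<not> (AE t in TT. g t = 0)"
    and "\<exists>f\<in>toeplitz_kernel g. \<not> (AE t in TT. f t = 0)"
  shows "(AE t in TT. g t \<noteq> 0) \<and>
         (\<forall>k. maximal_vector g k \<longleftrightarrow>
              H2 k \<and> (\<exists>p. outer p \<and> (AE t in TT. k t = cis (- t) * cnj (p t) / g t)))"
proof -
  have gnz: "AE t in TT. g t \<noteq> 0" using symbol_nonzero_AE assms(2,3) by blast
  have "H2 k \<and> (\<exists>p. outer p \<and> (AE t in TT. k t = cis (- t) * cnj (p t) / g t))"
    if "maximal_vector g k" for k
  proof (intro conjI exI)
    show "H2 k" using that by (simp add: maximal_vector_def is_min_toeplitz_kernel_def)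
    show "outer (cshift (\<lambda>t. g t * k t))" by (rule outer_if_maximal_vector[OF assms(1) gnz that])
    \<comment> \<open>The witness works because \<open>cshift\<close> is an involution: conj (z p)
      is \<open>g k\<close> again.\<close>
    show "AE t in TT. k t = cis (- t) * cnj (cshift (\<lambda>t. g t * k t) t) / g t"
      using gnz by eventually_elim (simp add: cshift_def cis_cnj cis_mult flip: mult.assoc)
  qed
  with gnz show ?thesis using maximal_vector_if_outer[OF assms(1) gnz] by blast
qed

end
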